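(* Let $K$ be a real quadratic field and let $G(z_1,z_2,\dots,z_r)$ be a totally positive definite integral generalized quadratic form in $r$ variables over $K$. If $G$ is universal, then $G$ has a universal quadratic subform; that is, there is a generalized quadratic form $H$ that is a subform of $G$, has no proper variables, and is universal.
   Context: $K=\mathbb{Q}(\sqrt D)\subset\mathbb{R}$ is a real quadratic field, $\mathcal{O}_K$ its ring of integers, and $\tau:K\to K$, $a+b\sqrt D\mapsto a-b\sqrt D$, its non-trivial automorphism. An element $\alpha\in K$ is totally positive, written $\alpha\succ0$, if $\alpha>0$ and $\tau(\alpha)>0$; write $\alpha\succeq 0$ if $\alpha\ge0$ and $\tau(\alpha)\ge0$. $\mathcal{O}_K^+$ is the set of totally positive elements of $\mathcal{O}_K$. A quadratic form over $K$ in $n$ variables is a homogeneous quadratic polynomial $Q(x_1,\dots,x_n)=\sum_{1\le i\le j\le n}a_{ij}x_ix_j$ with $a_{ij}\in K$; it is integral if all $a_{ij}\in\mathcal{O}_K$. It is totally positive definite (resp. semidefinite) if $Q(x)\succ0$ (resp. $Q(x)\succeq0$) for all $x\in K^n\setminus\{0\}$. A generalized quadratic form (generalized form) in $r$ variables over $K$ is an expression $G(z_1,\dots,z_r)=G_0(z_1,\tau(z_1),\dots,z_r,\tau(z_r))$, where $G_0$ is a quadratic form in $2r$ variables over $K$. It is integral if $G_0$ is integral. We say that $z_i$ (resp. $\tau(z_i)$) appears in $G$ if some monomial with non-zero coefficient in $G_0$ involves the corresponding variable of $G_0$. A variable $z_i$ is a proper variable of $G$ if both $z_i$ and $\tau(z_i)$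 appear in $G$. $G$ is called quadratic if it has no proper variables. Associated quadratic form: after reordering, let $z_1,\dots,z_\ell$ be the non-proper variables and $z_{\ell+1},\dots,z_r$ the proper variables of $G$. The associated quadratic form of $G$ is the quadratic form $Q$ in $2r-\ell$ variables with $G(z_1,\dots,z_r)=Q(z_1',\dots,z_\ell',z_{\ell+1},\tau(z_{\ell+1}),\dots,z_r,\tau(z_r))$ (as formal expressions, treating each $z_i$ and $\tau(z_i)$ as separate variables), where for $j\le\ell$, $z_j'$ is whichever of $z_j$, $\tau(z_j)$ appears in $G$ (if neither appears, put $z_j'=z_j$). $G$ is totally positive definite (resp. semidefinite) if its associated quadratic form $Q$ is totally positive definite (resp. semidefinite). An integral generalized form $G$ represents $\alpha\in\mathcal{O}_K$ if $G(\beta_1,\dots,\beta_r)=\alpha$ for some $\beta_1,\dots,\beta_r\in\mathcal{O}_K$. A totally positive semidefinite integral generalized form is universal if it represents every element of $\mathcal{O}_K^+$. A generalized form $H(z_1,\dots,z_k)$ is a subform of $G(z_1,\dots,z_r)$ if, after some reordering of the variables of $G$, $H(z_1,\dots,z_k)=G(z_1,\dots,z_k,0,\dots,0)$. *)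

theory Defs
  imports
    Complex_Main
    "HOL-Computational_Algebra.Polynomial"
    "HOL-Computational_Algebra.Squarefree"
begin

section \<open>Real quadratic fields\<close>

definition quad_field :: "nat \<Rightarrow> real set" where
  "quad_field D = {of_rat a + of_rat b * sqrt (real D) | a b. True}"

definition quad_ints :: "nat \<Rightarrow> real set" where
  "quad_ints D = {x \<in> quad_field D. algebraic_int x}"

text \<open>Only meaningful on \<^term>\<open>quad_field D\<close>, see \<open>quad_conj_eq\<close> below.\<close>

definition quad_conj :: "nat \<Rightarrow> real \<Rightarrow> real" where
  "quad_conj D x = (THE y. \<exists>a b. x = of_rat a + of_rat b * sqrt (real D) \<and>
                               y = of_rat a - of_rat b * sqrt (real D))"

definition tot_pos :: "nat \<Rightarrow> real \<Rightarrow> bool" where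
  "tot_pos D x \<longleftrightarrow> x > 0 \<and> quad_conj D x > 0"

definition tot_nonneg :: "nat \<Rightarrow> real \<Rightarrow> bool" where
  "tot_nonneg D x \<longleftrightarrow> x \<ge> 0 \<and> quad_conj D x \<ge> 0"

definition tot_pos_ints :: "nat \<Rightarrow> real set" where
  "tot_pos_ints D = {x \<in> quad_ints D. tot_pos D x}"

lemma sqrt_irrational:
  assumes "squarefree D" "D > 1"
  shows   "sqrt (real D) \<notin> \<rat>"
proof
  assume *: "sqrt (real D) \<in> \<rat>"
  have "algebraic_int (sqrt (real D))"
    by (intro algebraic_int_sqrt algebraic_int_of_nat)
  with * have "sqrt (real D) \<in> \<int>"
    using \<open>algebraic_int (sqrt (real D))\<close> by (intro rational_algebraic_int_is_int)
  then obtain m where m: "sqrt (real D) = of_int m"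
    by (auto elim: Ints_cases)
  have "real D = (sqrt (real D)) ^ 2" by simp
  also have "\<dots> = real (nat \<bar>m\<bar> ^ 2)" by (simp add: m)
  finally have D: "D = nat \<bar>m\<bar> ^ 2" by (simp only: of_nat_eq_iff)
  with assms(1) have "nat \<bar>m\<bar> = 1" using squarefreeD[of D "nat \<bar>m\<bar>"] by simp
  with D assms(2) show False by simp
qed

lemma quad_rep_unique:
  assumes "squarefree D" "D > 1"
    and eq: "of_rat a + of_rat b * sqrt (real D) = of_rat a' + of_rat b' * sqrt (real D)"
  shows "a = a' \<and> b = b'"
proof -
  have *: "of_rat (b - b') * sqrt (real D) = of_rat (a' - a)"
    using eq by (simp add: of_rat_diff algebra_simps)
  have "b = b'"
  proof (rule ccontr)
    assume "b \<noteq> b'"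
    then have "sqrt (real D) = of_rat ((a' - a) / (b - b'))"
      using * by (simp add: of_rat_divide field_simps)
    then show False using sqrt_irrational[OF assms(1,2)] by simp
  qed
  with * show ?thesis by simp
qed

lemma quad_conj_eq:
  assumes "squarefree D" "D > 1"
  shows "quad_conj D (of_rat a + of_rat b * sqrt (real D)) = of_rat a - of_rat b * sqrt (real D)"
  unfolding quad_conj_def
  by (rule the_equality) (use quad_rep_unique[OF assms] in blast)+


section \<open>Quadratic forms\<close>

text \<open>
  The form \<open>\<Sum>i\<le>j<n. a\<^sub>i\<^sub>j x\<^sub>i x\<^sub>j\<close> in variables \<open>x\<^sub>0, \<dots>, x\<^sub>n\<^sub>-\<^sub>1\<close> is given by its number of
  variables \<open>n\<close>, which is passed separately, and its coefficients. Entries outside of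
  \<open>i \<le> j < n\<close> carry no meaning and are ignored throughout.
\<close>

type_synonym qform = "nat \<Rightarrow> nat \<Rightarrow> real"

definition qf_over :: "real set \<Rightarrow> nat \<Rightarrow> qform \<Rightarrow> bool" where
  "qf_over S n A \<longleftrightarrow> (\<forall>i j. i \<le> j \<and> j < n \<longrightarrow> A i j \<in> S)"

definition qf_eval :: "nat \<Rightarrow> qform \<Rightarrow> (nat \<Rightarrow> real) \<Rightarrow> real" where
  "qf_eval n A x = (\<Sum>j<n. \<Sum>i\<le>j. A i j * x i * x j)"

definition qf_tot_pos_definite :: "nat \<Rightarrow> nat \<Rightarrow> qform \<Rightarrow> bool" where
  "qf_tot_pos_definite D n A \<longleftrightarrow>
     (\<forall>x. (\<forall>i<n. x i \<in> quad_field D) \<and> (\<exists>i<n. x i \<noteq> 0) \<longrightarrow> tot_pos D (qf_eval n A x))"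

definition qf_tot_pos_semidefinite :: "nat \<Rightarrow> nat \<Rightarrow> qform \<Rightarrow> bool" where
  "qf_tot_pos_semidefinite D n A \<longleftrightarrow>
     (\<forall>x. (\<forall>i<n. x i \<in> quad_field D) \<and> (\<exists>i<n. x i \<noteq> 0) \<longrightarrow> tot_nonneg D (qf_eval n A x))"

definition qf_appears :: "nat \<Rightarrow> qform \<Rightarrow> nat \<Rightarrow> bool" where
  "qf_appears n A p \<longleftrightarrow> (\<exists>i j. i \<le> j \<and> j < n \<and> A i j \<noteq> 0 \<and> (p = i \<or> p = j))"

text \<open>
  For injective \<open>f\<close>, the form obtained from \<open>A\<close> by renaming the variable \<open>x\<^sub>f\<^sub>p\<close> to \<open>x\<^sub>p\<close> for
  \<open>p < n\<close> and setting all variables outside of \<open>f ` {..<n}\<close> to 0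
  (see \<open>qf_eval_select\<close> below); \<open>min\<close> and \<open>max\<close> pick the coefficient of \<open>x\<^sub>f\<^sub>p x\<^sub>f\<^sub>q\<close> in \<open>A\<close>.
\<close>

definition qf_select :: "(nat \<Rightarrow> nat) \<Rightarrow> qform \<Rightarrow> qform" where
  "qf_select f A = (\<lambda>p q. A (min (f p) (f q)) (max (f p) (f q)))"

lemma qf_eval_pairs:
  "qf_eval n A x = (\<Sum>(i,j)\<in>{(i,j). i \<le> j \<and> j < n}. A i j * x i * x j)"
proof -
  have "qf_eval n A x = (\<Sum>(j,i)\<in>(SIGMA j:{..<n}. {..j}). A i j * x i * x j)"
    unfolding qf_eval_def by (rule sum.Sigma) auto
  also have "\<dots> = (\<Sum>(i,j)\<in>{(i,j). i \<le> j \<and> j < n}. A i j * x i * x j)"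
    by (rule sum.reindex_bij_witness[of _ "\<lambda>(i,j). (j,i)" "\<lambda>(i,j). (j,i)"]) auto
  finally show ?thesis .
qed

lemma qf_eval_select:
  assumes inj: "inj_on f {..<n}" and sub: "f ` {..<n} \<subseteq> {..<m}"
    and van: "\<And>i. i < m \<Longrightarrow> i \<notin> f ` {..<n} \<Longrightarrow> x i = 0 \<or> \<not> qf_appears m A i"
  shows "qf_eval m A x = qf_eval n (qf_select f A) (\<lambda>p. x (f p))"
proof -
  let ?P = "\<lambda>n. {(i,j). i \<le> j \<and> j < (n::nat)}"
  define h where "h = (\<lambda>(p,q). (min (f p) (f q), max (f p) (f q)))"
  have fin: "finite (?P m)"
    by (rule finite_subset[of _ "{..<m} \<times> {..<m}"]) auto
  have inj_h: "inj_on h (?P n)"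
  proof (rule inj_onI, clarify)
    fix p q p' q' assume *: "p \<le> q" "q < n" "p' \<le> q'" "q' < n" "h (p,q) = h (p',q')"
    then have "f p = f p' \<and> f q = f q' \<or> f p = f q' \<and> f q = f p'"
      by (auto simp: h_def min_def max_def split: if_splits)
    moreover have "f u = f v \<Longrightarrow> u < n \<Longrightarrow> v < n \<Longrightarrow> u = v" for u v
      using inj by (auto simp: inj_on_def)
    ultimately show "p = p' \<and> q = q'" using * by (metis le_antisym le_less_trans)
  qed
  have "f p < m" if "p < n" for p using sub that by auto
  then have sub_h: "h ` ?P n \<subseteq> ?P m"
    by (auto simp: h_def min_def max_def)
  have "qf_eval m A x = (\<Sum>(i,j)\<in>h ` ?P n. A i j * x i * x j)"
    unfolding qf_eval_pairs
  proof (rule sum.mono_neutral_right[OF fin sub_h], clarify)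
    fix i j assume ij: "i \<le> j" "j < m" "(i,j) \<notin> h ` ?P n"
    have "i \<notin> f ` {..<n} \<or> j \<notin> f ` {..<n}"
    proof (rule ccontr)
      assume "\<not> ?thesis"
      then obtain p q where pq: "p < n" "q < n" "i = f p" "j = f q" by auto
      then have "(i,j) = h (min p q, max p q)" using ij(1) by (auto simp: h_def min_def max_def)
      moreover have "(min p q, max p q) \<in> ?P n" using pq by auto
      ultimately show False using ij(3) by blast
    qed
    then show "A i j * x i * x j = 0"
      using van[of i] van[of j] ij(1,2) by (auto simp: qf_appears_def)
  qed
  also have "\<dots> = (\<Sum>(p,q)\<in>?P n. qf_select f A p q * x (f p) * x (f q))"
    by (subst sum.reindex[OF inj_h])
       (auto intro!: sum.cong simp: h_def qf_select_def min_def max_def)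
  also have "\<dots> = qf_eval n (qf_select f A) (\<lambda>p. x (f p))"
    by (simp add: qf_eval_pairs)
  finally show ?thesis .
qed


section \<open>Generalized quadratic forms\<close>

text \<open>
  A generalized form \<open>G\<close> in variables \<open>z\<^sub>0, \<dots>, z\<^sub>r\<^sub>-\<^sub>1\<close> is given by \<open>r\<close> and the quadratic form
  \<open>G\<^sub>0\<close> in \<open>2r\<close> variables, where \<open>z\<^sub>i\<close> is substituted for the variable with index \<open>2i\<close> of \<open>G\<^sub>0\<close>
  and \<open>\<tau>(z\<^sub>i)\<close> for the one with index \<open>2i+1\<close>.
\<close>

definition gf_over_field :: "nat \<Rightarrow> nat \<Rightarrow> qform \<Rightarrow> bool" where
  "gf_over_field D r G \<longleftrightarrow> qf_over (quad_field D) (2 * r) G"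

definition gf_integral :: "nat \<Rightarrow> nat \<Rightarrow> qform \<Rightarrow> bool" where
  "gf_integral D r G \<longleftrightarrow> qf_over (quad_ints D) (2 * r) G"

definition gf_eval :: "nat \<Rightarrow> nat \<Rightarrow> qform \<Rightarrow> (nat \<Rightarrow> real) \<Rightarrow> real" where
  "gf_eval D r G z =
     qf_eval (2 * r) G (\<lambda>p. if even p then z (p div 2) else quad_conj D (z (p div 2)))"

definition gf_proper :: "nat \<Rightarrow> qform \<Rightarrow> nat \<Rightarrow> bool" where
  "gf_proper r G i \<longleftrightarrow> qf_appears (2 * r) G (2 * i) \<and> qf_appears (2 * r) G (2 * i + 1)"

definition gf_quadratic :: "nat \<Rightarrow> qform \<Rightarrow> bool" where
  "gf_quadratic r G \<longleftrightarrow> (\<forall>i<r. \<not> gf_proper r G i)"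

text \<open>
  The variables of the associated quadratic form, in order: for each non-proper variable \<open>z\<^sub>i\<close>
  the one of \<open>z\<^sub>i\<close>, \<open>\<tau>(z\<^sub>i)\<close> that appears (\<open>z\<^sub>i\<close> if neither does), then both \<open>z\<^sub>i\<close> and \<open>\<tau>(z\<^sub>i)\<close> for
  each proper variable \<open>z\<^sub>i\<close>.
\<close>

definition gf_assoc_vars :: "nat \<Rightarrow> qform \<Rightarrow> nat list" where
  "gf_assoc_vars r G =
     map (\<lambda>i. if qf_appears (2 * r) G (2 * i + 1) then 2 * i + 1 else 2 * i)
         (filter (\<lambda>i. \<not> gf_proper r G i) [0..<r]) @
     concat (map (\<lambda>i. [2 * i, 2 * i + 1]) (filter (gf_proper r G) [0..<r]))"

definition gf_assoc_dim :: "nat \<Rightarrow> qform \<Rightarrow> nat" where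
  "gf_assoc_dim r G = length (gf_assoc_vars r G)"

definition gf_assoc :: "nat \<Rightarrow> qform \<Rightarrow> qform" where
  "gf_assoc r G = qf_select (\<lambda>p. gf_assoc_vars r G ! p) G"

definition gf_tot_pos_definite :: "nat \<Rightarrow> nat \<Rightarrow> qform \<Rightarrow> bool" where
  "gf_tot_pos_definite D r G \<longleftrightarrow> qf_tot_pos_definite D (gf_assoc_dim r G) (gf_assoc r G)"

definition gf_tot_pos_semidefinite :: "nat \<Rightarrow> nat \<Rightarrow> qform \<Rightarrow> bool" where
  "gf_tot_pos_semidefinite D r G \<longleftrightarrow> qf_tot_pos_semidefinite D (gf_assoc_dim r G) (gf_assoc r G)"

definition gf_represents :: "nat \<Rightarrow> nat \<Rightarrow> qform \<Rightarrow> real \<Rightarrow> bool" where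
  "gf_represents D r G \<alpha> \<longleftrightarrow> (\<exists>\<beta>. (\<forall>i<r. \<beta> i \<in> quad_ints D) \<and> gf_eval D r G \<beta> = \<alpha>)"

definition gf_universal :: "nat \<Rightarrow> nat \<Rightarrow> qform \<Rightarrow> bool" where
  "gf_universal D r G \<longleftrightarrow>
     gf_integral D r G \<and> gf_tot_pos_semidefinite D r G \<and> (\<forall>\<alpha>\<in>tot_pos_ints D. gf_represents D r G \<alpha>)"

text \<open>
  The action on \<open>G\<^sub>0\<close> of the reordering which moves \<open>z\<^sub>\<sigma>\<^sub>i\<close>, together with \<open>\<tau>(z\<^sub>\<sigma>\<^sub>i)\<close>, to position \<open>i\<close>.
\<close>

definition gf_lift :: "(nat \<Rightarrow> nat) \<Rightarrow> nat \<Rightarrow> nat" where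
  "gf_lift \<sigma> p = 2 * \<sigma> (p div 2) + p mod 2"

definition gf_subform :: "nat \<Rightarrow> qform \<Rightarrow> nat \<Rightarrow> qform \<Rightarrow> bool" where
  "gf_subform k H r G \<longleftrightarrow> k \<le> r \<and>
     (\<exists>\<sigma>. bij_betw \<sigma> {..<r} {..<r} \<and>
          (\<forall>p q. p \<le> q \<and> q < 2 * k \<longrightarrow> H p q = qf_select (gf_lift \<sigma>) G p q))"

lemma gf_eval_subform:
  assumes "squarefree D" "D > 1" "gf_subform k H r G"
  obtains \<sigma> where "bij_betw \<sigma> {..<r} {..<r}"
    and "\<And>z. (\<And>i. k \<le> i \<Longrightarrow> i < r \<Longrightarrow> z (\<sigma> i) = 0) \<Longrightarrow> gf_eval D k H (\<lambda>i. z (\<sigma> i)) = gf_eval D r G z"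
proof -
  from assms(3) obtain \<sigma> where kr: "k \<le> r" and bij: "bij_betw \<sigma> {..<r} {..<r}"
    and H: "\<And>p q. p \<le> q \<Longrightarrow> q < 2 * k \<Longrightarrow> H p q = qf_select (gf_lift \<sigma>) G p q"
    by (auto simp: gf_subform_def)
  have conj_0: "quad_conj D 0 = 0"
    using quad_conj_eq[OF assms(1,2), of 0 0] by simp
  have lift_parts: "gf_lift \<sigma> p div 2 = \<sigma> (p div 2)" "even (gf_lift \<sigma> p) \<longleftrightarrow> even p" for p
    by (auto simp: gf_lift_def)
  have "gf_eval D k H (\<lambda>i. z (\<sigma> i)) = gf_eval D r G z"
    if z: "\<And>i. k \<le> i \<Longrightarrow> i < r \<Longrightarrow> z (\<sigma> i) = 0" for z
  proof -
    let ?x = "\<lambda>p. if even p then z (p div 2) else quad_conj D (z (p div 2))"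
    have "qf_eval (2 * r) G ?x = qf_eval (2 * k) (qf_select (gf_lift \<sigma>) G) (\<lambda>p. ?x (gf_lift \<sigma> p))"
    proof (rule qf_eval_select)
      show "inj_on (gf_lift \<sigma>) {..<2 * k}"
      proof (rule inj_onI)
        fix p q assume *: "p \<in> {..<2 * k}" "q \<in> {..<2 * k}" "gf_lift \<sigma> p = gf_lift \<sigma> q"
        have "\<sigma> (p div 2) = \<sigma> (q div 2)" "even p \<longleftrightarrow> even q"
          using lift_parts[of p] lift_parts[of q] *(3) by simp_all
        moreover have "p div 2 < r" "q div 2 < r" using * kr by auto
        ultimately have "p div 2 = q div 2" "even p \<longleftrightarrow> even q"
          using bij by (auto simp: bij_betw_def inj_on_def)
        then show "p = q" by presburger
      qed
      show "gf_lift \<sigma> ` {..<2 * k} \<subseteq> {..<2 * r}"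
      proof clarify
        fix p assume "p < 2 * k"
        then have "\<sigma> (p div 2) < r" using bij kr by (auto simp: bij_betw_def)
        then show "gf_lift \<sigma> p < 2 * r" unfolding gf_lift_def by presburger
      qed
      fix i assume i: "i < 2 * r" "i \<notin> gf_lift \<sigma> ` {..<2 * k}"
      then have "i div 2 \<in> \<sigma> ` {..<r}" using bij by (auto simp: bij_betw_def)
      then obtain j where j: "j < r" "i div 2 = \<sigma> j" by auto
      have "k \<le> j"
      proof (rule ccontr)
        assume "\<not> k \<le> j"
        then have "2 * j + i mod 2 < 2 * k" by presburger
        moreover have "i = gf_lift \<sigma> (2 * j + i mod 2)"
          using j(2) by (simp add: gf_lift_def flip: j(2))
        ultimately show False using i(2) by blast
      qed
      then show "?x i = 0 \<or> \<not> qf_appears (2 * r) G i" using z j conj_0 by simp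
    qed
    also have "\<dots> = qf_eval (2 * k) H (\<lambda>p. ?x (gf_lift \<sigma> p))"
      unfolding qf_eval_def by (intro sum.cong) (auto simp: H)
    finally show ?thesis by (simp add: gf_eval_def lift_parts cong: if_cong)
  qed
  with bij show thesis by (rule that)
qed

lemma gf_assoc_dim_eq:
  "gf_assoc_dim r G = 2 * r - card {i\<in>{..<r}. \<not> gf_proper r G i}"
proof -
  have card: "length (filter P [0..<r]) = card {i\<in>{..<r}. P i}" for P
    by (subst distinct_card[symmetric]) (auto intro!: arg_cong[where f = card])
  have "length (concat (map (\<lambda>i::nat. [2 * i, 2 * i + 1]) xs)) = 2 * length xs" for xs
    by (induction xs) auto
  then have "gf_assoc_dim r G =
      length (filter (\<lambda>i. \<not> gf_proper r G i) [0..<r]) + 2 * length (filter (gf_proper r G) [0..<r])"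
    by (simp add: gf_assoc_dim_def gf_assoc_vars_def)
  then show ?thesis
    using sum_length_filter_compl[of "gf_proper r G" "[0..<r]"] card by simp
qed

lemma set_gf_assoc_vars:
  fixes G :: qform
  shows "set (gf_assoc_vars r G) \<subseteq> {..<2 * r}"
    and "p < 2 * r \<Longrightarrow> p \<notin> set (gf_assoc_vars r G) \<Longrightarrow> \<not> qf_appears (2 * r) G p"
proof -
  show "set (gf_assoc_vars r G) \<subseteq> {..<2 * r}"
    by (auto simp: gf_assoc_vars_def)
  assume p: "p < 2 * r" "p \<notin> set (gf_assoc_vars r G)"
  define i where "i = p div 2"
  have i: "i < r" "p = 2 * i \<or> p = 2 * i + 1" using p(1) by (auto simp: i_def)
  show "\<not> qf_appears (2 * r) G p"
  proof
    assume app: "qf_appears (2 * r) G p"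
    have "p \<in> set (gf_assoc_vars r G)"
    proof (cases "gf_proper r G i")
      case True
      then show ?thesis using i by (auto simp: gf_assoc_vars_def intro!: bexI[of _ i])
    next
      case False
      then have "p = (if qf_appears (2 * r) G (2 * i + 1) then 2 * i + 1 else 2 * i)"
        using app i(2) by (auto simp: gf_proper_def)
      then show ?thesis using i(1) False unfolding gf_assoc_vars_def by (simp add: image_iff)
    qed
    with p(2) show False by simp
  qed
qed

lemma distinct_gf_assoc_vars: "distinct (gf_assoc_vars r G)"
proof -
  have "distinct (concat (map (\<lambda>i::nat. [2 * i, 2 * i + 1]) xs))" if "distinct xs" for xs
    using that by (induction xs) (auto, presburger+)
  moreover have "inj_on (\<lambda>i::nat. if P i then 2 * i + 1 else 2 * i) A" for P A
    by (rule inj_onI) (simp split: if_splits; presburger)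
  ultimately show ?thesis
    unfolding gf_assoc_vars_def
    by (auto simp: distinct_map split: if_splits) presburger+
qed

text \<open>The defining identity of the associated form, with \<open>z\<^sub>i\<close> and \<open>\<tau>(z\<^sub>i)\<close> independent.\<close>

lemma qf_eval_gf_assoc:
  "qf_eval (2 * r) G x =
   qf_eval (gf_assoc_dim r G) (gf_assoc r G) (\<lambda>p. x (gf_assoc_vars r G ! p))"
proof -
  let ?vs = "gf_assoc_vars r G"
  have im: "(\<lambda>p. ?vs ! p) ` {..<gf_assoc_dim r G} = set ?vs"
    by (auto simp: gf_assoc_dim_def set_conv_nth)
  show ?thesis
    unfolding gf_assoc_def
  proof (rule qf_eval_select)
    show "inj_on (\<lambda>p. ?vs ! p) {..<gf_assoc_dim r G}"
      using distinct_gf_assoc_vars[of r G]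
      by (auto simp: inj_on_def gf_assoc_dim_def nth_eq_iff_index_eq)
  qed (use im set_gf_assoc_vars[where r = r and G = G] in auto)
qed

end

(*
  For a unit w of norm 1 with w large, the element \<tau>(w)\<^sup>2 \<alpha> is again totally positive, but tiny as a real number. Since
  a totally positive definite form is coercive on K\<^sup>n, any representation of it by G has all entries
  of the associated form small; for a proper variable these include both \<beta>\<^sub>i and \<tau>(\<beta>\<^sub>i), so \<beta>\<^sub>i has norm
  less than 1 in absolute value and vanishes. In a non-proper variable \<beta>\<^sub>i can be rescaled by w or \<tau>(w),
  which turns this into a representation of \<alpha> by the form in the non-proper variables alone.
*)
theory Submission
  imports Defs "HOL-Analysis.Kronecker_Approximation_Theorem"
begin

section \<open>Definite forms over subfields of the reals\<close>

text \<open>The obstacle is coercivity: definiteness is known only on K^n, which is dense in real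
  space, so a minimum over the real unit sphere might a priori be 0. Over the rationals, (x - sqrt 2
  * y)^2 is positive at every non-zero vector and yet takes arbitrarily small values at large ones.
  What excludes this is that the coefficients lie in the same field as the vectors: orthogonal
  projections then stay inside K^n, and the constants that they produce are values of the form at
  non-zero vectors of K^n.

  A unit w of norm 1 acts on z_i by w and on \<tau>(z_i) by the inverse of w. A variable seen
  through one embedding only can therefore be rescaled so that whatever appears is multiplied by w,
  whereas a proper variable cannot; this is why the proper ones must first be shown to vanish. The
  unit comes from Pell's equation, and products of integers from a criterion for integrality that
  avoids resultants.\<close>

locale real_subfield =
  fixes F :: "real set"
  assumes one_closed: "1 \<in> F"
    and diff_closed: "x \<in> F \<Longrightarrow> y \<in> F \<Longrightarrow> x - y \<in> F"
    and mult_closed: "x \<in> F \<Longrightarrow> y \<in> F \<Longrightarrow> x * y \<in> F"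
    and inverse_closed: "x \<in> F \<Longrightarrow> inverse x \<in> F"
begin

lemma zero_closed: "0 \<in> F"
  using diff_closed[OF one_closed one_closed] by simp

lemma add_closed: "x \<in> F \<Longrightarrow> y \<in> F \<Longrightarrow> x + y \<in> F"
  using diff_closed[of x "0 - y"] diff_closed[OF zero_closed, of y] by simp

lemma divide_closed: "x \<in> F \<Longrightarrow> y \<in> F \<Longrightarrow> x / y \<in> F"
  by (simp add: divide_inverse mult_closed inverse_closed)

lemma sum_closed: "(\<And>i. i \<in> S \<Longrightarrow> f i \<in> F) \<Longrightarrow> sum f S \<in> F"
  by (induction S rule: infinite_finite_induct) (auto intro: zero_closed add_closed)

lemmas closed = zero_closed one_closed add_closed diff_closed mult_closed divide_closed

end

section \<open>Polarization and orthogonal projection\<close>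

definition qf_polar :: "nat \<Rightarrow> qform \<Rightarrow> (nat \<Rightarrow> real) \<Rightarrow> (nat \<Rightarrow> real) \<Rightarrow> real" where
  "qf_polar n A x y = (\<Sum>j<n. \<Sum>i\<le>j. A i j * (x i * y j + y i * x j))"

lemma qf_polar_self: "qf_polar n A x x = 2 * qf_eval n A x"
  by (simp add: qf_polar_def qf_eval_def sum_distrib_left mult_ac flip: mult_2)

lemma qf_polar_commute: "qf_polar n A x y = qf_polar n A y x"
  by (simp add: qf_polar_def algebra_simps)

lemma qf_polar_linear:
  "qf_polar n A x (\<lambda>i. c * y i + z i) = c * qf_polar n A x y + qf_polar n A x z"
proof -
  have "qf_polar n A x (\<lambda>i. c * y i + z i) =
      (\<Sum>j<n. \<Sum>i\<le>j. c * (A i j * (x i * y j + y i * x j)) + A i j * (x i * z j + z i * x j))"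
    by (simp add: qf_polar_def algebra_simps)
  also have "\<dots> = c * qf_polar n A x y + qf_polar n A x z"
    by (simp add: qf_polar_def sum.distrib sum_distrib_left)
  finally show ?thesis .
qed

lemma qf_polar_linear_left:
  "qf_polar n A (\<lambda>i. y i - c * z i) x = qf_polar n A y x - c * qf_polar n A z x"
  using qf_polar_linear[of n A x "-c" z y] by (simp add: qf_polar_commute[of n A _ x])

lemma qf_eval_cong: "(\<And>i. i < n \<Longrightarrow> x i = y i) \<Longrightarrow> qf_eval n A x = qf_eval n A y"
  by (auto simp: qf_eval_def intro!: sum.cong)

context real_subfield
begin

lemma qf_polar_closed:
  assumes "qf_over F n A" "\<And>i. x i \<in> F" "\<And>i. y i \<in> F"
  shows   "qf_polar n A x y \<in> F"
  using assms by (auto simp: qf_polar_def qf_over_def intro!: sum_closed closed)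

text \<open>Gram-Schmidt, one coordinate at a time. The only divisions are by values
  \<open>?B ps ps\<close>, which are positive because \<open>ps\<close> is a non-zero vector over
  \<open>F\<close>; hence the projection of \<open>u\<close> to the coordinate space of
  \<open>T\<close> again has entries in \<open>F\<close>.\<close>

lemma orthogonal_projection_exists:
  assumes A: "qf_over F n A"
    and pos: "\<And>x. (\<forall>i. x i \<in> F) \<Longrightarrow> \<exists>i<n. x i \<noteq> 0 \<Longrightarrow> qf_eval n A x > 0"
    and "finite T" "T \<subseteq> {..<n}" "\<And>i. u i \<in> F"
  shows "\<exists>w. (\<forall>i. w i \<in> F) \<and> (\<forall>i. i \<notin> T \<longrightarrow> w i = 0) \<and>
           (\<forall>v. (\<forall>i. v i \<in> F) \<and> (\<forall>i. i \<notin> T \<longrightarrow> v i = 0) \<longrightarrow> qf_polar n A (\<lambda>i. u i - w i) v = 0)"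
  using assms(3-5)
proof (induction T arbitrary: u rule: finite_induct)
  case empty
  show ?case
    by (rule exI[of _ "\<lambda>_. 0"]) (auto simp: qf_polar_def closed)
next
  case (insert s T)
  let ?B = "qf_polar n A"
  have T: "T \<subseteq> {..<n}" using insert.prems(1) by simp
  from insert.IH[OF T insert.prems(2)]
  obtain wu where wu: "(\<forall>i. wu i \<in> F) \<and> (\<forall>i. i \<notin> T \<longrightarrow> wu i = 0) \<and>
      (\<forall>v. (\<forall>i. v i \<in> F) \<and> (\<forall>i. i \<notin> T \<longrightarrow> v i = 0) \<longrightarrow> ?B (\<lambda>i. u i - wu i) v = 0)" ..
  define e where "e = (\<lambda>i. if i = s then 1 else 0 :: real)"
  have e: "e i \<in> F" for i by (simp add: e_def closed)
  from insert.IH[OF T e]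
  obtain ws where ws: "(\<forall>i. ws i \<in> F) \<and> (\<forall>i. i \<notin> T \<longrightarrow> ws i = 0) \<and>
      (\<forall>v. (\<forall>i. v i \<in> F) \<and> (\<forall>i. i \<notin> T \<longrightarrow> v i = 0) \<longrightarrow> ?B (\<lambda>i. e i - ws i) v = 0)" ..
  define pu where "pu = (\<lambda>i. u i - wu i)"
  define ps where "ps = (\<lambda>i. e i - ws i)"
  have F: "pu i \<in> F" "ps i \<in> F" for i
    using insert.prems wu ws e by (auto simp: pu_def ps_def intro: closed)
  have ps_s: "ps s = 1" using insert.hyps ws by (simp add: ps_def e_def)
  have ps_0: "ps i = 0" if "i \<notin> insert s T" for i
    using that ws by (simp add: ps_def e_def)
  have "?B ps ps > 0"
    using pos[of ps] F ps_s insert.prems(1) exI[of "\<lambda>i. i < n \<and> ps i \<noteq> 0" s]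
    by (simp add: qf_polar_self)
  \<comment> \<open>This coefficient makes \<open>pu - t * ps\<close> orthogonal to the new
    direction \<open>ps\<close>; orthogonality to the vectors supported on \<open>T\<close> is
    inherited from \<open>pu\<close> and \<open>ps\<close>.\<close>
  define t where "t = ?B pu ps / ?B ps ps"
  have t: "t \<in> F" unfolding t_def by (intro closed qf_polar_closed A F)
  show ?case
  proof (rule exI[of _ "\<lambda>i. wu i + t * ps i"], intro conjI allI impI)
    fix i
    show "wu i + t * ps i \<in> F" using wu by (intro closed t F) auto
    show "wu i + t * ps i = 0" if "i \<notin> insert s T"
      using that wu ps_0 by simp
  next
    fix v assume v: "(\<forall>i. v i \<in> F) \<and> (\<forall>i. i \<notin> insert s T \<longrightarrow> v i = 0)"
    \<comment> \<open>Since \<open>ps s = 1\<close>, subtracting \<open>v s * ps\<close> removes the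
      coordinate \<open>s\<close>, and what remains is supported on \<open>T\<close>, where the
      orthogonality of \<open>pu\<close> and \<open>ps\<close> applies.\<close>
    define v' where "v' = (\<lambda>i. v i - v s * ps i)"
    have v': "\<forall>i. v' i \<in> F" "\<forall>i. i \<notin> T \<longrightarrow> v' i = 0"
    proof -
      show "\<forall>i. v' i \<in> F" unfolding v'_def using v by (auto intro!: closed F)
      have "v' i = 0" if "i \<notin> T" for i
        using that v ps_s ps_0[of i] by (cases "i = s") (simp_all add: v'_def)
      then show "\<forall>i. i \<notin> T \<longrightarrow> v' i = 0" by blast
    qed
    have v_eq: "v = (\<lambda>i. v s * ps i + v' i)" by (simp add: v'_def)
    have "?B (\<lambda>i. pu i - t * ps i) v = v s * (?B pu ps - t * ?B ps ps) + ?B pu v' - t * ?B ps v'"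
      by (subst v_eq) (simp only: qf_polar_linear qf_polar_linear_left)
    also have "\<dots> = 0"
      using wu ws v' \<open>?B ps ps > 0\<close> by (simp add: t_def pu_def ps_def)
    finally show "?B (\<lambda>i. u i - (wu i + t * ps i)) v = 0"
      by (simp add: pu_def algebra_simps)
  qed
qed

text \<open>For fixed p let q be the p-th unit vector minus its projection to the other coordinates.
  Then x = x_p q + y with y supported off p and orthogonal to q, so Q(x) = x_p^2 Q(q) + Q(y) \<ge>
  x_p^2 Q(q). The constant Q(q) is positive because q has p-th entry 1 and lies in F^n.\<close>

lemma positive_definite_coercive:
  assumes A: "qf_over F n A"
    and pos: "\<And>x. (\<forall>i<n. x i \<in> F) \<Longrightarrow> \<exists>i<n. x i \<noteq> 0 \<Longrightarrow> qf_eval n A x > 0"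
  obtains c where "c > 0" "\<And>x p. \<forall>i<n. x i \<in> F \<Longrightarrow> p < n \<Longrightarrow> c * (x p)\<^sup>2 \<le> qf_eval n A x"
proof -
  let ?B = "qf_polar n A"
  have nonneg: "qf_eval n A x \<ge> 0" if "\<forall>i<n. x i \<in> F" for x
  proof (cases "\<exists>i<n. x i \<noteq> 0")
    case False
    then have "qf_eval n A x = qf_eval n A (\<lambda>_. 0)" by (intro qf_eval_cong) auto
    then show ?thesis by (simp add: qf_eval_def)
  qed (use pos[of x] that in auto)
  have pos': "qf_eval n A x > 0" if "\<forall>i. x i \<in> F" "\<exists>i<n. x i \<noteq> 0" for x
    using pos that by blast
  have "\<exists>c>0. \<forall>x. (\<forall>i<n. x i \<in> F) \<longrightarrow> c * (x p)\<^sup>2 \<le> qf_eval n A x" if p: "p < n" for p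
  proof -
    define T where "T = {..<n} - {p}"
    define e where "e = (\<lambda>i. if i = p then 1 else 0 :: real)"
    have e: "e i \<in> F" for i by (simp add: e_def closed)
    have T: "finite T" "T \<subseteq> {..<n}" by (auto simp: T_def)
    from orthogonal_projection_exists[where T = T and u = e, OF A pos' T e]
    obtain w where w: "(\<forall>i. w i \<in> F) \<and> (\<forall>i. i \<notin> T \<longrightarrow> w i = 0) \<and>
        (\<forall>v. (\<forall>i. v i \<in> F) \<and> (\<forall>i. i \<notin> T \<longrightarrow> v i = 0) \<longrightarrow> ?B (\<lambda>i. e i - w i) v = 0)" ..
    define q where "q = (\<lambda>i. e i - w i)"
    have q: "q i \<in> F" for i unfolding q_def using e w by (intro closed) auto
    have q_p: "q p = 1" using w by (simp add: q_def e_def T_def)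
    show ?thesis
    proof (intro exI[of _ "qf_eval n A q"] conjI allI impI)
      show "qf_eval n A q > 0" using pos[of q] q p exI[of "\<lambda>i. i < n \<and> q i \<noteq> 0" p] by (simp add: q_p)
      fix x assume x: "\<forall>i<n. x i \<in> F"
      \<comment> \<open>Cut off at \<open>n\<close>, because nothing is known about the entries of
        \<open>x\<close> beyond, while the orthogonality of \<open>q\<close> concerns vectors with
        all entries in \<open>F\<close>.\<close>
      define y where "y = (\<lambda>i. if i < n then x i - x p * q i else 0)"
      have y: "\<forall>i. y i \<in> F" "\<forall>i. i \<notin> T \<longrightarrow> y i = 0"
        using x q p by (auto simp: y_def T_def q_p intro!: closed)
      let ?z = "\<lambda>i. x p * q i + y i"
      have "2 * qf_eval n A x = ?B ?z ?z"
        unfolding qf_polar_self by (auto intro!: qf_eval_cong simp: y_def)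
      also have "\<dots> = x p * ?B ?z q + ?B ?z y"
        by (rule qf_polar_linear)
      also have "\<dots> = x p * (x p * ?B q q + ?B q y) + (x p * ?B y q + ?B y y)"
        by (simp only: qf_polar_commute[of n A ?z] qf_polar_linear)
      also have "\<dots> = (x p)\<^sup>2 * ?B q q + ?B y y"
        using w y qf_polar_commute[of n A y q] by (simp add: q_def power2_eq_square)
      also have "\<dots> \<ge> (x p)\<^sup>2 * ?B q q"
        using nonneg[of y] y by (simp add: qf_polar_self)
      finally show "qf_eval n A q * (x p)\<^sup>2 \<le> qf_eval n A x"
        by (simp add: qf_polar_self mult.commute)
    qed
  qed
  then obtain c where c: "\<And>p. p < n \<Longrightarrow> c p > 0"
    "\<And>p x. p < n \<Longrightarrow> \<forall>i<n. x i \<in> F \<Longrightarrow> c p * (x p)\<^sup>2 \<le> qf_eval n A x"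
    by metis
  \<comment> \<open>The inserted 1 keeps the set non-empty when \<open>n = 0\<close>.\<close>
  define c0 where "c0 = Min (insert 1 (c ` {..<n}))"
  have "c0 > 0" unfolding c0_def by (subst Min_gr_iff) (auto simp: c)
  moreover have "c0 * (x p)\<^sup>2 \<le> qf_eval n A x" if "\<forall>i<n. x i \<in> F" "p < n" for x p
  proof -
    have "c0 \<le> c p" unfolding c0_def by (rule Min_le) (use that in auto)
    then have "c0 * (x p)\<^sup>2 \<le> c p * (x p)\<^sup>2" by (intro mult_right_mono) auto
    also have "\<dots> \<le> qf_eval n A x" using c that by blast
    finally show ?thesis .
  qed
  ultimately show thesis by (rule that)
qed

end

section \<open>Arithmetic in real quadratic fields\<close>

text \<open>The order Z[sqrt D], which can be smaller than the ring of integers. It serves as the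
  lattice against which denominators are measured.\<close>

definition quad_order :: "nat \<Rightarrow> real set" where
  "quad_order D = {of_int a + of_int b * sqrt (real D) | a b. True}"

lemma quad_orderI: "of_int a + of_int b * sqrt (real D) \<in> quad_order D"
  by (auto simp: quad_order_def)

lemma of_int_in_quad_order: "of_int a \<in> quad_order D"
  using quad_orderI[of a 0] by simp

lemma quad_order_add: "x \<in> quad_order D \<Longrightarrow> y \<in> quad_order D \<Longrightarrow> x + y \<in> quad_order D"
proof -
  assume "x \<in> quad_order D" "y \<in> quad_order D"
  then obtain a b a' b' where "x = of_int a + of_int b * sqrt (real D)"
    "y = of_int a' + of_int b' * sqrt (real D)" by (auto simp: quad_order_def)
  then have "x + y = of_int (a + a') + of_int (b + b') * sqrt (real D)" by (simp add: algebra_simps)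
  then show ?thesis by (simp only: quad_orderI)
qed

lemma quad_order_mult: "x \<in> quad_order D \<Longrightarrow> y \<in> quad_order D \<Longrightarrow> x * y \<in> quad_order D"
proof -
  assume "x \<in> quad_order D" "y \<in> quad_order D"
  then obtain a b a' b' where "x = of_int a + of_int b * sqrt (real D)"
    "y = of_int a' + of_int b' * sqrt (real D)" by (auto simp: quad_order_def)
  then have "x * y = of_int (a * a' + int D * b * b') + of_int (a * b' + a' * b) * sqrt (real D)"
    by (simp add: algebra_simps)
  then show ?thesis by (simp only: quad_orderI)
qed

lemma quad_order_power: "x \<in> quad_order D \<Longrightarrow> x ^ n \<in> quad_order D"
  using of_int_in_quad_order[of 1 D] by (induction n) (auto intro: quad_order_mult)

lemma quad_order_sum: "(\<And>i. i \<in> S \<Longrightarrow> f i \<in> quad_order D) \<Longrightarrow> sum f S \<in> quad_order D"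
  using of_int_in_quad_order[of 0 D]
  by (induction S rule: infinite_finite_induct) (auto intro: quad_order_add)

lemma quad_order_subset_field: "quad_order D \<subseteq> quad_field D"
proof
  fix x assume "x \<in> quad_order D"
  then obtain a b where "x = of_int a + of_int b * sqrt (real D)" by (auto simp: quad_order_def)
  then have "x = of_rat (of_int a) + of_rat (of_int b) * sqrt (real D)" by simp
  then show "x \<in> quad_field D" unfolding quad_field_def by blast
qed

lemma quad_fieldI: "of_rat a + of_rat b * sqrt (real D) \<in> quad_field D"
  by (auto simp: quad_field_def)

lemma quad_field_common_denominator:
  assumes "x \<in> quad_field D"
  shows   "\<exists>m::nat>0. of_nat m * x \<in> quad_order D"
proof -
  from assms obtain a b where x: "x = of_rat a + of_rat b * sqrt (real D)"
    by (auto simp: quad_field_def)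
  obtain p q where a: "q > 0" "a = of_int p / of_int q"
    using quotient_of_div quotient_of_denom_pos by (metis surj_pair)
  obtain p' q' where b: "q' > 0" "b = of_int p' / of_int q'"
    using quotient_of_div quotient_of_denom_pos by (metis surj_pair)
  have "of_nat (nat (q * q')) * x = of_int (p * q') + of_int (p' * q) * sqrt (real D)"
    using a(1) b(1) unfolding x a(2) b(2) by (simp add: of_rat_divide field_simps)
  moreover have "nat (q * q') > 0" using a b by simp
  ultimately show ?thesis by (metis quad_orderI)
qed

text \<open>For y = a/b in lowest terms, b^i divides M for every i. The exponent i = M already
  suffices: b \<ge> 2 would give b^M \<ge> 2^M > M.\<close>

lemma rational_bounded_denominators_imp_Ints:
  fixes y :: real
  assumes "y \<in> \<rat>" "M > 0" "\<And>i. of_nat M * y ^ i \<in> \<int>"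
  shows   "y \<in> \<int>"
proof -
  from assms(1) obtain a b :: int where ab: "b > 0" "coprime a b" "y = of_int a / of_int b"
    by (auto elim: Rats_cases')
  from assms(3)[of M] obtain k where "of_nat M * y ^ M = of_int k" by (auto elim: Ints_cases)
  then have "of_int (int M * a ^ M) = (of_int (k * b ^ M) :: real)"
    using ab by (simp add: field_simps)
  then have "int M * a ^ M = k * b ^ M" by (simp only: of_int_eq_iff)
  then have "b ^ M dvd int M * a ^ M" by simp
  moreover have "coprime (b ^ M) (a ^ M)" using ab(2) by (simp add: coprime_commute)
  ultimately have "b ^ M dvd int M" by (simp add: coprime_dvd_mult_left_iff)
  then have le: "b ^ M \<le> int M" using assms(2) by (intro zdvd_imp_le) auto
  have "b = 1"
  proof (rule ccontr)
    assume "b \<noteq> 1"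
    then have "2 ^ M \<le> b ^ M" using ab(1) by (intro power_mono) auto
    moreover have "int M < 2 ^ M" by (simp add: of_nat_less_two_power)
    ultimately show False using le by simp
  qed
  then show ?thesis using ab by simp
qed

context
  fixes D :: nat
  assumes sf: "squarefree D" and D1: "D > 1"
begin

private lemmas conj_eq = quad_conj_eq[OF sf D1]

section \<open>Conjugation, norm and the field structure\<close>

lemma quad_conj_add:
  assumes "x \<in> quad_field D" "y \<in> quad_field D"
  shows   "quad_conj D (x + y) = quad_conj D x + quad_conj D y"
proof -
  from assms obtain a b a' b' where xy: "x = of_rat a + of_rat b * sqrt (real D)"
    "y = of_rat a' + of_rat b' * sqrt (real D)" by (auto simp: quad_field_def)
  have "x + y = of_rat (a + a') + of_rat (b + b') * sqrt (real D)"
    by (simp add: xy of_rat_add algebra_simps)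
  then show ?thesis by (simp only: conj_eq xy) (simp add: of_rat_add algebra_simps)
qed

lemma quad_conj_mult:
  assumes "x \<in> quad_field D" "y \<in> quad_field D"
  shows   "quad_conj D (x * y) = quad_conj D x * quad_conj D y"
proof -
  from assms obtain a b a' b' where xy: "x = of_rat a + of_rat b * sqrt (real D)"
    "y = of_rat a' + of_rat b' * sqrt (real D)" by (auto simp: quad_field_def)
  have "x * y = of_rat (a * a' + of_nat D * b * b') + of_rat (a * b' + a' * b) * sqrt (real D)"
    by (simp add: xy of_rat_add of_rat_mult algebra_simps)
  then show ?thesis by (simp only: conj_eq xy) (simp add: of_rat_add of_rat_mult algebra_simps)
qed

lemma quad_conj_rat: "quad_conj D (of_rat a) = of_rat a"
  using conj_eq[of a 0] by simp

lemma quad_conj_0: "quad_conj D 0 = 0"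
  using quad_conj_rat[of 0] by simp

lemma quad_conj_closed: "x \<in> quad_field D \<Longrightarrow> quad_conj D x \<in> quad_field D"
proof -
  assume "x \<in> quad_field D"
  then obtain a b where x: "x = of_rat a + of_rat b * sqrt (real D)" by (auto simp: quad_field_def)
  then have "quad_conj D x = of_rat a + of_rat (-b) * sqrt (real D)"
    by (simp add: conj_eq of_rat_minus)
  then show ?thesis by (simp only: quad_fieldI)
qed

lemma quad_conj_conj: "x \<in> quad_field D \<Longrightarrow> quad_conj D (quad_conj D x) = x"
proof -
  assume "x \<in> quad_field D"
  then obtain a b where x: "x = of_rat a + of_rat b * sqrt (real D)" by (auto simp: quad_field_def)
  then have "quad_conj D x = of_rat a + of_rat (-b) * sqrt (real D)"
    by (simp add: conj_eq of_rat_minus)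
  then show ?thesis by (simp only: conj_eq) (simp add: x of_rat_minus)
qed

lemma quad_conj_order: "quad_conj D (of_int a + of_int b * sqrt (real D)) = of_int a - of_int b * sqrt (real D)"
  using conj_eq[of "of_int a" "of_int b"] by simp

lemma rat_in_quad_field: "of_rat a \<in> quad_field D"
  using quad_fieldI[of a 0] by simp

lemma quad_norm_rat: "x \<in> quad_field D \<Longrightarrow> x * quad_conj D x \<in> \<rat>"
proof -
  assume "x \<in> quad_field D"
  then obtain a b where x: "x = of_rat a + of_rat b * sqrt (real D)" by (auto simp: quad_field_def)
  have "x * quad_conj D x = of_rat (a * a - of_nat D * b * b)"
    by (simp add: x conj_eq of_rat_diff of_rat_mult algebra_simps)
  then show ?thesis by simp
qed

lemma quad_norm_order: "x \<in> quad_order D \<Longrightarrow> x * quad_conj D x \<in> \<int>"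
proof -
  assume "x \<in> quad_order D"
  then obtain a b where x: "x = of_int a + of_int b * sqrt (real D)" by (auto simp: quad_order_def)
  have "x * quad_conj D x = of_int (a * a - int D * b * b)"
    unfolding x quad_conj_order by (simp add: algebra_simps)
  then show ?thesis by simp
qed

lemma quad_field_subfield: "real_subfield (quad_field D)"
proof
  show "1 \<in> quad_field D" using rat_in_quad_field[of 1] by simp
next
  fix x y assume "x \<in> quad_field D" "y \<in> quad_field D"
  then obtain a b a' b' where xy: "x = of_rat a + of_rat b * sqrt (real D)"
    "y = of_rat a' + of_rat b' * sqrt (real D)" by (auto simp: quad_field_def)
  have "x - y = of_rat (a - a') + of_rat (b - b') * sqrt (real D)"
    by (simp add: xy of_rat_diff algebra_simps)
  then show "x - y \<in> quad_field D" by (simp only: quad_fieldI)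
  have "x * y = of_rat (a * a' + of_nat D * b * b') + of_rat (a * b' + a' * b) * sqrt (real D)"
    by (simp add: xy of_rat_add of_rat_mult algebra_simps)
  then show mult: "x * y \<in> quad_field D" by (simp only: quad_fieldI)
next
  fix x assume x: "x \<in> quad_field D"
  then obtain a b where ab: "x = of_rat a + of_rat b * sqrt (real D)" by (auto simp: quad_field_def)
  show "inverse x \<in> quad_field D"
  proof (cases "x = 0")
    case True
    then show ?thesis using rat_in_quad_field[of 0] by simp
  next
    case False
    define N where "N = a * a - of_nat D * b * b"
    have N: "x * (of_rat a - of_rat b * sqrt (real D)) = of_rat N"
      by (simp add: N_def ab of_rat_diff of_rat_mult algebra_simps)
    have "of_rat a - of_rat b * sqrt (real D) \<noteq> 0"
      using quad_rep_unique[OF sf D1, of a "-b" 0 0] False by (auto simp: ab of_rat_minus)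
    with N False have "N \<noteq> 0" by force
    have "inverse x = of_rat (a / N) + of_rat (- b / N) * sqrt (real D)"
      using N False \<open>N \<noteq> 0\<close> by (simp add: of_rat_divide of_rat_minus field_simps)
    then show ?thesis by (simp only: quad_fieldI)
  qed
qed

interpretation real_subfield "quad_field D" by (rule quad_field_subfield)

lemma quad_field_power: "x \<in> quad_field D \<Longrightarrow> x ^ n \<in> quad_field D"
  by (induction n) (auto intro: closed)

lemma quad_conj_power: "x \<in> quad_field D \<Longrightarrow> quad_conj D (x ^ n) = quad_conj D x ^ n"
  using quad_conj_rat[of 1] by (induction n) (simp_all add: quad_conj_mult quad_field_power)

text \<open>
  Integrality is characterized by bounded denominators of the powers with respect to
  \<open>\<int>[\<surd>D]\<close>: unlike integrality itself, this property is visibly multiplicative.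
\<close>

lemma algebraic_int_imp_bounded_denominators:
  assumes x: "x \<in> quad_field D" and "algebraic_int x"
  shows   "\<exists>m::nat>0. \<forall>i. of_nat m * x ^ i \<in> quad_order D"
proof -
  from assms(2) obtain p where p: "lead_coeff p = 1" "\<forall>i. coeff p i \<in> \<int>" "poly p x = 0"
    by (auto elim: algebraic_int.cases)
  define d where "d = degree p"
  obtain M :: nat where M: "M > 0" "of_nat M * x \<in> quad_order D"
    using quad_field_common_denominator[OF x] by blast
  have eq: "x ^ d = - (\<Sum>i<d. coeff p i * x ^ i)"
    using p by (simp add: poly_altdef d_def flip: lessThan_Suc_atMost)
  \<comment> \<open>For i \<le> d the factor M^d leaves enough copies of M to clear x^i; higher
    powers are reduced by the monic equation, whose integer coefficients create no new
    denominators.\<close>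
  have "of_nat (M ^ d) * x ^ i \<in> quad_order D" for i
  proof (induction i rule: less_induct)
    case (less i)
    show ?case
    proof (cases "i \<le> d")
      case True
      then have "of_nat (M ^ d) * x ^ i = of_int (int M ^ (d - i)) * (of_nat M * x) ^ i"
        by (simp add: power_mult_distrib flip: power_add)
      then show ?thesis
        by (metis quad_order_mult of_int_in_quad_order quad_order_power M(2))
    next
      case False
      then have "of_nat (M ^ d) * x ^ i = of_nat (M ^ d) * (x ^ (i - d) * x ^ d)"
        by (simp flip: power_add)
      also have "\<dots> = (\<Sum>j<d. (- coeff p j) * (of_nat (M ^ d) * x ^ (i - d + j)))"
        unfolding eq by (simp add: sum_distrib_left sum_negf power_add algebra_simps)
      also have "\<dots> \<in> quad_order D"
      proof (rule quad_order_sum, rule quad_order_mult)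
        fix j assume "j \<in> {..<d}"
        then show "of_nat (M ^ d) * x ^ (i - d + j) \<in> quad_order D"
          using False by (intro less.IH) auto
        have "- coeff p j \<in> \<int>" using p by simp
        then show "- coeff p j \<in> quad_order D" by (metis Ints_cases of_int_in_quad_order)
      qed
      finally show ?thesis .
    qed
  qed
  then show ?thesis using M(1) by (intro exI[of _ "M ^ d"]) auto
qed

text \<open>The norm is rational, and m^2 N(x)^i = N(m x^i) is an integer for all i, so the powers
  of the rational number N(x) have bounded denominators as well.\<close>

lemma bounded_denominators_imp_norm_int:
  assumes x: "x \<in> quad_field D" and "m > 0" and m: "\<And>i. of_nat m * x ^ i \<in> quad_order D"
  shows   "x * quad_conj D x \<in> \<int>"
proof (rule rational_bounded_denominators_imp_Ints)
  show "x * quad_conj D x \<in> \<rat>" using x by (rule quad_norm_rat)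
  show "m * m > 0" using \<open>m > 0\<close> by simp
  fix i
  have "of_nat m \<in> quad_field D" "quad_conj D (of_nat m) = of_nat m"
    using rat_in_quad_field[of "of_nat m"] quad_conj_rat[of "of_nat m"] by simp_all
  then have "of_nat (m * m) * (x * quad_conj D x) ^ i =
      (of_nat m * x ^ i) * quad_conj D (of_nat m * x ^ i)"
    using x by (simp add: quad_conj_mult quad_conj_power quad_field_power power_mult_distrib)
  then show "of_nat (m * m) * (x * quad_conj D x) ^ i \<in> \<int>"
    using quad_norm_order[OF m] by (simp only:)
qed

text \<open>The trace is N(x + 1) - N(x) - 1. By the binomial theorem, \<open>x + 1\<close>
  satisfies the same hypothesis with the same \<open>m\<close>, so both norms are integers.\<close>

lemma bounded_denominators_imp_trace_int:
  assumes x: "x \<in> quad_field D" and "m > 0" and m: "\<And>i. of_nat m * x ^ i \<in> quad_order D"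
  shows   "x + quad_conj D x \<in> \<int>"
proof -
  have "of_nat m * (x + 1) ^ i \<in> quad_order D" for i
  proof -
    have "of_nat m * (x + 1) ^ i = (\<Sum>j\<le>i. of_int (int (i choose j)) * (of_nat m * x ^ j))"
      using binomial_ring[of x 1 i] by (simp add: sum_distrib_left algebra_simps)
    also have "\<dots> \<in> quad_order D"
      by (intro quad_order_sum quad_order_mult of_int_in_quad_order m)
    finally show ?thesis .
  qed
  then have "(x + 1) * quad_conj D (x + 1) \<in> \<int>"
    using assms closed by (intro bounded_denominators_imp_norm_int) auto
  moreover have "quad_conj D (x + 1) = quad_conj D x + 1"
    using x quad_conj_add[of x 1] closed quad_conj_rat[of 1] by simp
  then have "x + quad_conj D x = (x + 1) * quad_conj D (x + 1) - x * quad_conj D x - 1"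
    by (simp add: algebra_simps)
  ultimately show ?thesis
    using bounded_denominators_imp_norm_int[OF assms] by simp
qed

lemma norm_trace_int_imp_quad_int:
  assumes "x \<in> quad_field D" "x * quad_conj D x \<in> \<int>" "x + quad_conj D x \<in> \<int>"
  shows   "x \<in> quad_ints D"
proof -
  define N T where "N = x * quad_conj D x" and "T = - (x + quad_conj D x)"
  have NT: "N \<in> \<int>" "T \<in> \<int>"
    unfolding N_def T_def using assms(2,3) by (simp_all only: minus_in_Ints_iff)
  have "algebraic_int x"
  proof (rule algebraic_int.intros)
    show "lead_coeff [:N, T, 1:] = 1" by simp
    show "\<forall>i. coeff [:N, T, 1:] i \<in> \<int>"
      using NT by (auto simp: coeff_pCons split: nat.splits)
    show "poly [:N, T, 1:] x = 0" by (simp add: T_def N_def algebra_simps)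
  qed
  with assms(1) show ?thesis by (simp add: quad_ints_def)
qed

text \<open>Closes the circle: integrality bounds the denominators, bounded denominators make norm
  and trace integers, and these are, up to the sign of the trace, the coefficients of a monic
  quadratic equation for \<open>x\<close>.\<close>

lemma quad_ints_iff:
  "x \<in> quad_ints D \<longleftrightarrow>
     x \<in> quad_field D \<and> (\<exists>m::nat>0. \<forall>i. of_nat m * x ^ i \<in> quad_order D)"
  using algebraic_int_imp_bounded_denominators norm_trace_int_imp_quad_int
    bounded_denominators_imp_trace_int bounded_denominators_imp_norm_int
  by (auto simp: quad_ints_def)

lemma quad_order_subset_ints: "x \<in> quad_order D \<Longrightarrow> x \<in> quad_ints D"
  unfolding quad_ints_iff using quad_order_subset_field
  by (auto intro!: exI[of _ 1] quad_order_power)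

lemma quad_ints_mult:
  assumes "x \<in> quad_ints D" "y \<in> quad_ints D"
  shows   "x * y \<in> quad_ints D"
proof -
  obtain m m' :: nat where m: "m > 0" "\<And>i. of_nat m * x ^ i \<in> quad_order D"
    "m' > 0" "\<And>i. of_nat m' * y ^ i \<in> quad_order D"
    using assms unfolding quad_ints_iff by blast
  have "of_nat (m * m') * (x * y) ^ i \<in> quad_order D" for i
    using quad_order_mult[OF m(2,4)[of i]] by (simp add: power_mult_distrib mult_ac)
  then show ?thesis
    using assms m unfolding quad_ints_iff
    by (auto intro: closed intro!: exI[of _ "m * m'"])
qed

lemma quad_ints_norm: "x \<in> quad_ints D \<Longrightarrow> x * quad_conj D x \<in> \<int>"
  unfolding quad_ints_iff using bounded_denominators_imp_norm_int by blast

lemma quad_ints_conj: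
  assumes "x \<in> quad_ints D"
  shows   "quad_conj D x \<in> quad_ints D"
proof (rule norm_trace_int_imp_quad_int)
  have x: "x \<in> quad_field D" using assms by (simp add: quad_ints_def)
  then show "quad_conj D x \<in> quad_field D" by (rule quad_conj_closed)
  show "quad_conj D x * quad_conj D (quad_conj D x) \<in> \<int>"
    using quad_ints_norm[OF assms] by (simp add: quad_conj_conj[OF x] mult.commute)
  show "quad_conj D x + quad_conj D (quad_conj D x) \<in> \<int>"
    using assms bounded_denominators_imp_trace_int unfolding quad_ints_iff
    by (auto simp: quad_conj_conj[OF x] add.commute)
qed

text \<open>The norm is an integer of absolute value below 1, hence 0, and conjugation is injective.
  This discreteness is what turns small entries of a representation into zeros.\<close>

lemma quad_int_eq_0:
  assumes x: "x \<in> quad_ints D" and "\<bar>x\<bar> < 1" "\<bar>quad_conj D x\<bar> < 1"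
  shows   "x = 0"
proof -
  have "\<bar>x * quad_conj D x\<bar> < 1"
    using mult_strict_mono'[OF assms(2,3)] by (simp add: abs_mult)
  then have "x * quad_conj D x = 0"
    using quad_ints_norm[OF x] Ints_nonzero_abs_less1 by blast
  moreover have "x = 0" if "quad_conj D x = 0"
    using quad_conj_conj[of x] that x by (simp add: quad_conj_0 quad_ints_def)
  ultimately show ?thesis by auto
qed

end

section \<open>Pell's equation\<close>

text \<open>The factor h - k sqrt D is below 1/k and the factor h + k sqrt D is at most k (2 sqrt D
  + 1), so k cancels in the product.\<close>

lemma approx_set_small_norm:
  assumes "(h, k) \<in> approx_set (sqrt (real D))"
  shows   "\<bar>h\<^sup>2 - int D * k\<^sup>2\<bar> \<le> \<lceil>2 * sqrt (real D) + 1\<rceil>"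
proof -
  define s where "s = sqrt (real D)"
  have k: "k > 0" "\<bar>s - of_int h / of_int k\<bar> < 1 / (of_int k)\<^sup>2"
    using assms by (auto simp: approx_set_def s_def)
  then have k1: "(1::real) \<le> of_int k" by simp
  have "\<bar>of_int k * s - of_int h\<bar> = of_int k * \<bar>s - of_int h / of_int k\<bar>"
    using k by (simp add: field_simps flip: abs_mult_pos')
  also have "\<dots> < of_int k * (1 / (of_int k)\<^sup>2)"
    using k by (intro mult_strict_left_mono) auto
  also have "\<dots> = 1 / of_int k" by (simp add: power2_eq_square)
  finally have A: "\<bar>of_int k * s - of_int h\<bar> < 1 / of_int k" .
  also have "1 / of_int k \<le> (1::real)" using k1 by simp
  finally have "\<bar>of_int k * s - of_int h\<bar> < 1" .
  moreover have "0 \<le> of_int k * s" using k by (simp add: s_def)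
  ultimately have "\<bar>of_int k * s + of_int h\<bar> \<le> 2 * (of_int k * s) + 1"
    by linarith
  also have "\<dots> \<le> 2 * (of_int k * s) + of_int k" using k1 by simp
  finally have B: "\<bar>of_int k * s + of_int h\<bar> \<le> of_int k * (2 * s + 1)"
    by (simp add: algebra_simps)
  have "\<bar>of_int (h\<^sup>2 - int D * k\<^sup>2)\<bar> = \<bar>of_int k * s - of_int h\<bar> * \<bar>of_int k * s + of_int h\<bar>"
  proof -
    have "(of_int k * s - of_int h) * (of_int k * s + of_int h) = - of_int (h\<^sup>2 - int D * k\<^sup>2)"
      by (simp add: s_def algebra_simps power2_eq_square)
    then show ?thesis by (simp flip: abs_mult)
  qed
  also have "\<dots> \<le> 1 / of_int k * (of_int k * (2 * s + 1))"
    using A B k by (intro mult_mono) auto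
  also have "\<dots> = 2 * s + 1" using k by simp
  finally have "of_int \<bar>h\<^sup>2 - int D * k\<^sup>2\<bar> \<le> 2 * s + 1" by simp
  then show ?thesis unfolding s_def by linarith
qed

text \<open>
  By pigeonhole, two distinct good approximations \<open>h/k\<close> and \<open>h'/k'\<close> of \<open>\<surd>D\<close> give elements
  \<open>h + k\<surd>D\<close> and \<open>h' + k'\<surd>D\<close> with the same norm \<open>N\<close> that are congruent modulo \<open>N\<close>; their
  quotient is the desired unit.
\<close>

lemma pell_solution_exists:
  assumes "sqrt (real D) \<notin> \<rat>"
  shows   "\<exists>x y :: int. y \<noteq> 0 \<and> x\<^sup>2 - int D * y\<^sup>2 = 1"
proof -
  define A where "A = approx_set (sqrt (real D))"
  define M where "M = \<lceil>2 * sqrt (real D) + 1\<rceil>"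
  define nm where "nm = (\<lambda>(h,k). h\<^sup>2 - int D * k\<^sup>2)"
  define f where "f = (\<lambda>z. (nm z, fst z mod nm z, snd z mod nm z))"
  have inf: "infinite A"
    using assms by (simp add: A_def rational_iff_finite_approx_set)
  have A_pos: "k > 0" "coprime h k" if "(h, k) \<in> A" for h k
    using that by (auto simp: A_def approx_set_def)
  have nm_le: "\<bar>nm z\<bar> \<le> M" if "z \<in> A" for z
    using that approx_set_small_norm[of "fst z" "snd z" D]
    by (simp add: A_def M_def nm_def case_prod_unfold)
  have nm_nz: "nm z \<noteq> 0" if z: "z \<in> A" for z
  proof
    assume "nm z = 0"
    then have eq: "(fst z)\<^sup>2 = int D * (snd z)\<^sup>2" by (simp add: nm_def case_prod_unfold)
    have k: "snd z > 0" using A_pos(1)[of "fst z" "snd z"] z by simp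
    have "real_of_int ((fst z)\<^sup>2) = real_of_int (int D * (snd z)\<^sup>2)" by (simp only: eq)
    then have "real D = (of_int (fst z) / of_int (snd z))\<^sup>2"
      using k by (simp add: field_simps)
    then have "sqrt (real D) = \<bar>of_int (fst z) / of_int (snd z)\<bar>" by simp
    with assms show False by simp
  qed
  \<comment> \<open>The bound M on the norms also bounds the residues modulo them, so the infinitely
    many approximations fall into finitely many classes.\<close>
  have "f ` A \<subseteq> {-M..M} \<times> {-M..M} \<times> {-M..M}"
  proof
    fix w assume "w \<in> f ` A"
    then obtain z where z: "z \<in> A" "w = f z" by auto
    have "\<bar>a mod nm z\<bar> \<le> M" for a
      using abs_mod_less[OF nm_nz[OF z(1)], of a] nm_le[OF z(1)] by linarith
    from this[of "fst z"] this[of "snd z"] nm_le[OF z(1)]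
    show "w \<in> {-M..M} \<times> {-M..M} \<times> {-M..M}"
      by (auto simp: z(2) f_def abs_le_iff)
  qed
  then have "finite (f ` A)" by (rule finite_subset) auto
  then obtain z where z: "z \<in> A" "infinite {a \<in> A. f a = f z}"
    using pigeonhole_infinite[OF inf] by blast
  then have "infinite ({a \<in> A. f a = f z} - {z})" by simp
  then obtain z' where z': "z' \<in> A" "f z' = f z" "z' \<noteq> z"
    using infinite_imp_nonempty by blast
  obtain h k where hk: "z = (h, k)" by (cases z)
  obtain h' k' where hk': "z' = (h', k')" by (cases z')
  define N where "N = nm z"
  have N: "N = h\<^sup>2 - int D * k\<^sup>2" "N = h'\<^sup>2 - int D * k'\<^sup>2" "N \<noteq> 0"
    using z' z hk hk' nm_nz[of z] by (auto simp: N_def f_def nm_def)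
  have "h' mod N = h mod N" "k' mod N = k mod N"
    using z' hk hk' by (auto simp: N_def f_def nm_def)
  then have "N dvd h' - h" "N dvd k' - k" by (simp_all add: mod_eq_dvd_iff)
  then obtain u v where uv: "h' = h + N * u" "k' = k + N * v"
    by (metis add_diff_cancel_left' dvdE diff_add_cancel add.commute)
  \<comment> \<open>Here x + y sqrt D = (h + k sqrt D) / (h' + k' sqrt D). Multiplying numerator and
    denominator by h' - k' sqrt D gives coordinates over N; after substituting h' = h + N u and k' =
    k + N v the division by N can be carried out.\<close>
  define x where "x = 1 + h * u - int D * k * v"
  define y where "y = k * u - h * v"
  have x: "N * x = h * h' - int D * k * k'"
    unfolding x_def uv using N(1) by (simp add: algebra_simps power2_eq_square)
  have y: "N * y = k * h' - h * k'"
    unfolding y_def uv by (simp add: algebra_simps)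
  have "N\<^sup>2 * (x\<^sup>2 - int D * y\<^sup>2) = (N * x)\<^sup>2 - int D * (N * y)\<^sup>2"
    by (simp add: algebra_simps)
  also have "\<dots> = (h\<^sup>2 - int D * k\<^sup>2) * (h'\<^sup>2 - int D * k'\<^sup>2)"
    unfolding x y by (simp add: algebra_simps power2_eq_square)
  also have "\<dots> = N\<^sup>2 * 1" using N by (simp add: power2_eq_square)
  finally have "x\<^sup>2 - int D * y\<^sup>2 = 1" using N(3) by simp
  \<comment> \<open>If y = 0, then h/k = h'/k', and two equal fractions in lowest terms with
    positive denominators coincide.\<close>
  moreover have "y \<noteq> 0"
  proof
    assume "y = 0"
    then have "k * h' = h * k'" using y by simp
    moreover have "k > 0" "coprime h k" "k' > 0" "coprime h' k'"
      using A_pos z z' hk hk' by auto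
    ultimately have "k = k'"
      by (metis coprime_commute coprime_dvd_mult_left_iff coprime_dvd_mult_right_iff dvd_triv_left
            dvd_triv_right zdvd_antisym_nonneg less_imp_le)
    with \<open>k * h' = h * k'\<close> \<open>k > 0\<close> have "h = h'" by simp
    with \<open>k = k'\<close> z' hk hk' show False by simp
  qed
  ultimately show ?thesis by blast
qed

text \<open>Powers of a unit u > 1 of norm 1 are unbounded and keep norm 1. Taking absolute values
  in the Pell solution makes u > 1; other signs could give a negative unit or one below 1.\<close>

lemma exists_large_unit:
  assumes "squarefree D" "D > 1"
  shows   "\<exists>w\<in>quad_ints D. w > M \<and> w > 0 \<and> w * quad_conj D w = 1"
proof -
  obtain a b :: int where ab: "b \<noteq> 0" "a\<^sup>2 - int D * b\<^sup>2 = 1"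
    using pell_solution_exists[OF sqrt_irrational[OF assms]] by blast
  define u where "u = of_int \<bar>a\<bar> + of_int \<bar>b\<bar> * sqrt (real D)"
  have u_order: "u \<in> quad_order D" unfolding u_def by (rule quad_orderI)
  then have u_field: "u \<in> quad_field D" using quad_order_subset_field by blast
  have "u * quad_conj D u = of_int (\<bar>a\<bar>\<^sup>2 - int D * \<bar>b\<bar>\<^sup>2)"
    unfolding u_def quad_conj_order[OF assms] of_int_diff of_int_mult of_int_power
    by (simp add: algebra_simps power2_eq_square)
  then have norm: "u * quad_conj D u = 1" using ab by simp
  have "u > 1"
  proof -
    have "int D * b\<^sup>2 \<ge> 0" by simp
    then have "a \<noteq> 0" using ab(2) by (intro notI) (simp del: zero_le_mult_iff mult_nonneg_nonneg)
    then have "1 \<le> real_of_int \<bar>a\<bar>" by linarith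
    moreover have "0 < real_of_int \<bar>b\<bar> * sqrt (real D)" using ab assms(2) by simp
    ultimately show ?thesis by (simp add: u_def)
  qed
  then obtain n where n: "u ^ n > M" using real_arch_pow by blast
  have "u ^ n * quad_conj D (u ^ n) = (u * quad_conj D u) ^ n"
    by (simp add: quad_conj_power[OF assms u_field] power_mult_distrib)
  then have "u ^ n * quad_conj D (u ^ n) = 1" by (simp add: norm)
  moreover have "u ^ n \<in> quad_ints D"
    using quad_order_subset_ints[OF assms] quad_order_power[OF u_order] .
  ultimately show ?thesis using n \<open>u > 1\<close> by auto
qed

section \<open>Restriction to the non-proper variables\<close>

text \<open>Extension by zero: every value of a selected form is a value of the full form.\<close>

lemma qf_eval_select_extend:
  assumes inj: "inj_on f {..<n}" and sub: "f ` {..<n} \<subseteq> {..<m}"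
  defines "Y \<equiv> \<lambda>y q. if q \<in> f ` {..<n} then y (the_inv_into {..<n} f q) else 0"
  shows "qf_eval n (qf_select f A) y = qf_eval m A (Y y)"
proof -
  have "qf_eval m A (Y y) = qf_eval n (qf_select f A) (\<lambda>p. Y y (f p))"
    by (rule qf_eval_select[OF inj sub]) (simp add: Y_def)
  also have "\<dots> = qf_eval n (qf_select f A) y"
    by (intro qf_eval_cong) (simp add: Y_def the_inv_into_f_f[OF inj])
  finally show ?thesis by simp
qed

text \<open>Sign conditions on values thus pass to selected forms. It is used both for the passage
  from \<open>G\<close> to its restriction \<open>H\<close> and for the passage from a form to its
  associated form.\<close>

lemma select_eval_property:
  assumes "inj_on f {..<n}" "f ` {..<n} \<subseteq> {..<m}" "0 \<in> F"
    and "\<And>x. (\<And>i. i < m \<Longrightarrow> x i \<in> F) \<Longrightarrow> P (qf_eval m A x)"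
    and "\<And>i. i < n \<Longrightarrow> y i \<in> F"
  shows "P (qf_eval n (qf_select f A) y)"
  unfolding qf_eval_select_extend[OF assms(1,2)]
  by (rule assms(4)) (auto simp: assms(3,5) the_inv_into_f_f[OF assms(1)])

section \<open>Semidefiniteness and the variables of the associated form\<close>

lemma gf_assoc_vars_inj: "inj_on (\<lambda>p. gf_assoc_vars r G ! p) {..<gf_assoc_dim r G}"
  using distinct_gf_assoc_vars[of r G]
  by (auto simp: inj_on_def gf_assoc_dim_def nth_eq_iff_index_eq)

lemma gf_assoc_vars_image:
  "(\<lambda>p. gf_assoc_vars r G ! p) ` {..<gf_assoc_dim r G} = set (gf_assoc_vars r G)"
  by (auto simp: gf_assoc_dim_def set_conv_nth)

lemma gf_assoc_vars_less: "p < gf_assoc_dim r G \<Longrightarrow> gf_assoc_vars r G ! p < 2 * r"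
  using set_gf_assoc_vars(1)[of r G] gf_assoc_vars_image[of r G] by blast

text \<open>Working with z_i and \<tau>(z_i) as independent variables avoids any comparison of the
  associated variables of a form with those of its subform.\<close>

lemma gf_tot_pos_semidefiniteI:
  assumes "0 \<in> quad_field D"
    and "\<And>x. (\<And>i. i < 2 * r \<Longrightarrow> x i \<in> quad_field D) \<Longrightarrow> tot_nonneg D (qf_eval (2 * r) G x)"
  shows "gf_tot_pos_semidefinite D r G"
  unfolding gf_tot_pos_semidefinite_def qf_tot_pos_semidefinite_def gf_assoc_def
proof (intro allI impI, elim conjE)
  fix x :: "nat \<Rightarrow> real"
  assume x: "\<forall>i<gf_assoc_dim r G. x i \<in> quad_field D"
  have "(\<lambda>p. gf_assoc_vars r G ! p) ` {..<gf_assoc_dim r G} \<subseteq> {..<2 * r}"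
    using gf_assoc_vars_less by auto
  from gf_assoc_vars_inj this assms x
  show "tot_nonneg D (qf_eval (gf_assoc_dim r G) (qf_select ((!) (gf_assoc_vars r G)) G) x)"
    by (intro select_eval_property[where P = "tot_nonneg D" and F = "quad_field D"]) auto
qed

text \<open>Strict positivity is lost here: a non-zero vector in all 2r variables may vanish at
  every variable of the associated form, for instance when it is supported on the missing conjugate
  of a non-proper variable.\<close>

lemma gf_tot_pos_definite_imp_tot_nonneg:
  assumes "quad_conj D 0 = 0" "gf_tot_pos_definite D r G"
    and "\<And>i. i < 2 * r \<Longrightarrow> x i \<in> quad_field D"
  shows "tot_nonneg D (qf_eval (2 * r) G x)"
proof -
  let ?y = "\<lambda>p. x (gf_assoc_vars r G ! p)"
  have y: "\<forall>p<gf_assoc_dim r G. ?y p \<in> quad_field D"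
    using assms(3) gf_assoc_vars_less by blast
  show ?thesis
  proof (cases "\<exists>p<gf_assoc_dim r G. ?y p \<noteq> 0")
    case True
    then show ?thesis
      using assms(2) y unfolding gf_tot_pos_definite_def qf_tot_pos_definite_def qf_eval_gf_assoc
      by (auto simp: tot_pos_def tot_nonneg_def less_imp_le)
  next
    case False
    then have "qf_eval (2 * r) G x = qf_eval (gf_assoc_dim r G) (gf_assoc r G) (\<lambda>_. 0)"
      unfolding qf_eval_gf_assoc by (intro qf_eval_cong) auto
    then show ?thesis using assms(1) by (simp add: qf_eval_def tot_nonneg_def)
  qed
qed

lemma qf_select_over:
  assumes "qf_over S m A" "\<And>i. i < n \<Longrightarrow> f i < m"
  shows "qf_over S n (qf_select f A)"
  using assms by (auto simp: qf_over_def qf_select_def)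

lemma qf_appears_select:
  assumes "qf_appears n (qf_select f A) p" "\<And>i. i < n \<Longrightarrow> f i < m"
  shows "qf_appears m A (f p)"
proof -
  from assms(1) obtain i j where ij: "i \<le> j" "j < n" "p = i \<or> p = j"
    "A (min (f i) (f j)) (max (f i) (f j)) \<noteq> 0"
    by (auto simp: qf_appears_def qf_select_def)
  then show ?thesis
    using assms(2)[of i] assms(2)[of j] unfolding qf_appears_def
    by (intro exI[of _ "min (f i) (f j)"] exI[of _ "max (f i) (f j)"]) (auto simp: min_def max_def)
qed

text \<open>The restriction to variables that appear is essential for the application: the absent
  conjugate of a rescaled variable is multiplied by the inverse unit instead.\<close>

lemma qf_eval_scale:
  assumes "\<And>i. i < n \<Longrightarrow> qf_appears n A i \<Longrightarrow> x i = c * y i"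
  shows "qf_eval n A x = c\<^sup>2 * qf_eval n A y"
  unfolding qf_eval_def sum_distrib_left
proof (intro sum.cong refl)
  fix i j assume "j \<in> {..<n}" "i \<in> {..j}"
  then have "A i j = 0 \<or> x i = c * y i \<and> x j = c * y j"
    using assms[of i] assms[of j] by (auto simp: qf_appears_def)
  then show "A i j * x i * x j = c\<^sup>2 * (A i j * y i * y j)"
    by (auto simp: power2_eq_square)
qed

section \<open>Selection of variables together with their conjugates\<close>

lemma gf_lift_div: "gf_lift \<sigma> p div 2 = \<sigma> (p div 2)"
  by (simp add: gf_lift_def)

lemma even_gf_lift: "even (gf_lift \<sigma> p) \<longleftrightarrow> even p"
  by (auto simp: gf_lift_def)

lemma gf_lift_less:
  assumes "\<And>i. i < k \<Longrightarrow> \<sigma> i < r" "p < 2 * k"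
  shows "gf_lift \<sigma> p < 2 * r"
proof -
  have "\<sigma> (p div 2) < r" using assms by auto
  then show ?thesis unfolding gf_lift_def by presburger
qed

lemma gf_lift_inj:
  assumes "inj_on \<sigma> {..<k}"
  shows "inj_on (gf_lift \<sigma>) {..<2 * k}"
proof (rule inj_onI)
  fix p q assume *: "p \<in> {..<2 * k}" "q \<in> {..<2 * k}" "gf_lift \<sigma> p = gf_lift \<sigma> q"
  then have "\<sigma> (p div 2) = \<sigma> (q div 2)" "even p \<longleftrightarrow> even q"
    by (metis gf_lift_div even_gf_lift)+
  moreover have "p div 2 \<in> {..<k}" "q div 2 \<in> {..<k}" using * by auto
  ultimately have "p div 2 = q div 2" "even p \<longleftrightarrow> even q"
    using assms by (auto simp: inj_on_def)
  then show "p = q" by presburger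
qed

text \<open>In contrast to \<open>gf_eval_subform\<close>, which yields some reordering, \<sigma> is
  prescribed here; it has to be the one that enumerates the non-proper variables first.\<close>

lemma gf_eval_select_lift:
  assumes inj: "inj_on \<sigma> {..<k}" and less: "\<And>i. i < k \<Longrightarrow> \<sigma> i < r"
    and 0: "quad_conj D 0 = 0" and z: "\<And>i. i < r \<Longrightarrow> i \<notin> \<sigma> ` {..<k} \<Longrightarrow> z i = 0"
  shows "gf_eval D k (qf_select (gf_lift \<sigma>) G) (\<lambda>i. z (\<sigma> i)) = gf_eval D r G z"
proof -
  let ?x = "\<lambda>p. if even p then z (p div 2) else quad_conj D (z (p div 2))"
  have "qf_eval (2 * r) G ?x = qf_eval (2 * k) (qf_select (gf_lift \<sigma>) G) (\<lambda>p. ?x (gf_lift \<sigma> p))"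
  proof (rule qf_eval_select)
    show "inj_on (gf_lift \<sigma>) {..<2 * k}" by (rule gf_lift_inj[OF inj])
    show "gf_lift \<sigma> ` {..<2 * k} \<subseteq> {..<2 * r}" using gf_lift_less[of k \<sigma> r] less by auto
    fix i assume i: "i < 2 * r" "i \<notin> gf_lift \<sigma> ` {..<2 * k}"
    have "i div 2 \<notin> \<sigma> ` {..<k}"
    proof
      assume "i div 2 \<in> \<sigma> ` {..<k}"
      then obtain j where "j < k" "i div 2 = \<sigma> j" by auto
      then have "i = gf_lift \<sigma> (2 * j + i mod 2)" "2 * j + i mod 2 < 2 * k"
        by (simp_all add: gf_lift_def flip: \<open>i div 2 = \<sigma> j\<close>)
      then show False using i(2) by blast
    qed
    then show "?x i = 0 \<or> \<not> qf_appears (2 * r) G i" using i(1) z[of "i div 2"] 0 by auto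
  qed
  then show ?thesis by (simp add: gf_eval_def gf_lift_div even_gf_lift cong: if_cong)
qed

lemma exists_nonproper_reordering:
  obtains k \<sigma> where "k \<le> r" "bij_betw \<sigma> {..<r} {..<r}"
    "\<sigma> ` {..<k} = {i. i < r \<and> \<not> gf_proper r G i}"
proof -
  define xs where "xs = filter (\<lambda>i. \<not> gf_proper r G i) [0..<r]"
  define ys where "ys = filter (gf_proper r G) [0..<r]"
  have len: "length (xs @ ys) = r"
    using sum_length_filter_compl[of "gf_proper r G" "[0..<r]"] by (simp add: xs_def ys_def)
  show thesis
  proof (rule that[of "length xs" "\<lambda>i. (xs @ ys) ! i"])
    show "length xs \<le> r" using len by simp
    show "bij_betw (\<lambda>i. (xs @ ys) ! i) {..<r} {..<r}"
      by (rule bij_betw_nth) (use len in \<open>auto simp: xs_def ys_def\<close>)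
    have "(\<lambda>i. (xs @ ys) ! i) ` {..<length xs} = set xs"
      by (auto simp: nth_append set_conv_nth)
    then show "(\<lambda>i. (xs @ ys) ! i) ` {..<length xs} = {i. i < r \<and> \<not> gf_proper r G i}"
      by (auto simp: xs_def)
  qed
qed

text \<open>The threshold \<open>c\<close> is the coercivity constant of the associated form, so
  every entry at a value below \<open>c\<close> has absolute value below 1. It depends on
  \<open>G\<close> alone, which allows a unit to be chosen afterwards in terms of \<open>c\<close>
  and the element to be represented.\<close>

lemma gf_proper_vanish:
  assumes D: "squarefree D" "D > 1" and G: "gf_integral D r G" and "gf_tot_pos_definite D r G"
  obtains c where "c > 0"
    "\<And>\<beta> i. (\<And>j. j < r \<Longrightarrow> \<beta> j \<in> quad_ints D) \<Longrightarrow> gf_eval D r G \<beta> < c \<Longrightarrow>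
        i < r \<Longrightarrow> gf_proper r G i \<Longrightarrow> \<beta> i = 0"
proof -
  interpret real_subfield "quad_field D" by (rule quad_field_subfield[OF D])
  let ?n = "gf_assoc_dim r G" and ?v = "\<lambda>p. gf_assoc_vars r G ! p"
  have "qf_over (quad_field D) (2 * r) G"
    using G by (auto simp: gf_integral_def qf_over_def quad_ints_def)
  then have over: "qf_over (quad_field D) ?n (gf_assoc r G)"
    unfolding gf_assoc_def by (rule qf_select_over) (rule gf_assoc_vars_less)
  have "qf_eval ?n (gf_assoc r G) x > 0" if "\<forall>i<?n. x i \<in> quad_field D" "\<exists>i<?n. x i \<noteq> 0" for x
    using assms(4) that by (auto simp: gf_tot_pos_definite_def qf_tot_pos_definite_def tot_pos_def)
  then obtain c where c: "c > 0"
    "\<And>x p. \<forall>i<?n. x i \<in> quad_field D \<Longrightarrow> p < ?n \<Longrightarrow> c * (x p)\<^sup>2 \<le> qf_eval ?n (gf_assoc r G) x"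
    using positive_definite_coercive[OF over] by blast
  show thesis
  proof (rule that[OF c(1)])
    fix \<beta> i
    assume \<beta>: "\<And>j. j < r \<Longrightarrow> \<beta> j \<in> quad_ints D" and small: "gf_eval D r G \<beta> < c"
      and i: "i < r" "gf_proper r G i"
    define x where "x = (\<lambda>p. if even p then \<beta> (p div 2) else quad_conj D (\<beta> (p div 2)))"
    have x: "x p \<in> quad_field D" if "p < 2 * r" for p
      using \<beta>[of "p div 2"] that quad_conj_closed[OF D] by (auto simp: x_def quad_ints_def)
    have eval: "qf_eval ?n (gf_assoc r G) (\<lambda>p. x (?v p)) < c"
      using small by (simp add: gf_eval_def x_def qf_eval_gf_assoc)
    have less_1: "\<bar>x p\<bar> < 1" if "p \<in> set (gf_assoc_vars r G)" for p
    proof -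
      from that obtain q where q: "q < ?n" "p = ?v q"
        using gf_assoc_vars_image[of r G] by blast
      have "c * (x p)\<^sup>2 \<le> qf_eval ?n (gf_assoc r G) (\<lambda>p. x (?v p))"
        unfolding q(2) by (rule c(2)) (use q x gf_assoc_vars_less in auto)
      with eval have "c * (x p)\<^sup>2 < c * 1" by simp
      with \<open>c > 0\<close> have "(x p)\<^sup>2 < 1" by (simp only: mult_less_cancel_left_pos)
      then show ?thesis by (simp add: abs_square_less_1)
    qed
    have "2 * i \<in> set (gf_assoc_vars r G)" "2 * i + 1 \<in> set (gf_assoc_vars r G)"
      using i by (auto simp: gf_assoc_vars_def)
    from this[THEN less_1] show "\<beta> i = 0"
      by (intro quad_int_eq_0[OF D \<beta>[OF i(1)]]) (simp_all add: x_def)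
  qed
qed

text \<open>Only the first real embedding of the represented element is made small; its conjugate
  grows. Hence the non-proper entries, which are controlled in just one embedding, need not
  vanish.\<close>

lemma gf_represents_with_proper_vanishing:
  assumes D: "squarefree D" "D > 1" and G: "gf_tot_pos_definite D r G" "gf_universal D r G"
    and \<alpha>: "\<alpha> \<in> tot_pos_ints D"
  obtains \<gamma> where "\<And>i. i < r \<Longrightarrow> \<gamma> i \<in> quad_ints D" "gf_eval D r G \<gamma> = \<alpha>"
    "\<And>i. i < r \<Longrightarrow> gf_proper r G i \<Longrightarrow> \<gamma> i = 0"
proof -
  have int: "gf_integral D r G" using G(2) by (simp add: gf_universal_def)
  obtain c where c: "c > 0" and vanish:
    "\<And>\<beta> i. (\<And>j. j < r \<Longrightarrow> \<beta> j \<in> quad_ints D) \<Longrightarrow> gf_eval D r G \<beta> < c \<Longrightarrow>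
        i < r \<Longrightarrow> gf_proper r G i \<Longrightarrow> \<beta> i = 0"
    using gf_proper_vanish[OF D int G(1)] by blast
  \<comment> \<open>With w > \<alpha>/c and w > 1 one gets \<alpha> < w c \<le> w^2 c, and
    multiplication by the square of 1/w brings the value below c.\<close>
  obtain w where w: "w \<in> quad_ints D" "w > max 1 (\<alpha> / c)" "w * quad_conj D w = 1"
    using exists_large_unit[OF D, of "max 1 (\<alpha> / c)"] by blast
  define w' where "w' = quad_conj D w"
  have w_field: "w \<in> quad_field D" "w' \<in> quad_field D"
    using w quad_conj_closed[OF D] by (auto simp: quad_ints_def w'_def)
  have conj_w': "quad_conj D w' = w"
    using quad_conj_conj[OF D] w_field by (simp add: w'_def)
  have w': "w * w' = 1" using w by (simp add: w'_def)
  have w'_int: "w' \<in> quad_ints D"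
    unfolding w'_def by (rule quad_ints_conj[OF D w(1)])
  have \<alpha>_int: "\<alpha> \<in> quad_ints D" and \<alpha>_pos: "\<alpha> > 0" "quad_conj D \<alpha> > 0"
    using \<alpha> by (auto simp: tot_pos_ints_def tot_pos_def)
  define \<alpha>' where "\<alpha>' = w' * w' * \<alpha>"
  have "\<alpha>' \<in> tot_pos_ints D"
  proof -
    have "\<alpha>' \<in> quad_ints D"
      unfolding \<alpha>'_def by (intro quad_ints_mult[OF D] w'_int \<alpha>_int)
    moreover have "quad_conj D \<alpha>' = w * w * quad_conj D \<alpha>"
      using w_field \<alpha>_int quad_ints_mult[OF D w'_int w'_int]
      by (simp add: \<alpha>'_def quad_conj_mult[OF D] conj_w' quad_ints_def)
    moreover have "w' \<noteq> 0" using w' by auto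
    ultimately show ?thesis
      using \<alpha>_pos w(2) by (auto simp: tot_pos_ints_def tot_pos_def \<alpha>'_def zero_less_mult_iff)
  qed
  then obtain \<beta> where \<beta>: "\<And>i. i < r \<Longrightarrow> \<beta> i \<in> quad_ints D" "gf_eval D r G \<beta> = \<alpha>'"
    using G(2) by (auto simp: gf_universal_def gf_represents_def)
  have "\<alpha>' < c"
  proof -
    have "w' > 0" using zero_less_mult_pos[of w w'] w' w(2) by simp
    have "\<alpha> < w * c" using w(2) c by (simp add: field_simps)
    also have "\<dots> \<le> w * w * c" using w(2) c by simp
    finally have "w' * w' * \<alpha> < w' * w' * (w * w * c)"
      using \<open>w' > 0\<close> by (intro mult_strict_left_mono) auto
    also have "\<dots> = (w * w') * (w * w') * c" by (simp only: mult_ac)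
    finally show ?thesis by (simp add: w' \<alpha>'_def)
  qed
  with vanish \<beta> have \<beta>_0: "\<beta> i = 0" if "i < r" "gf_proper r G i" for i
    using that by metis
  \<comment> \<open>If \<tau>(z_i) appears, the factor \<open>w'\<close> is right because
    conjugation turns it into \<open>w\<close>. For proper variables the choice is irrelevant since
    \<open>\<beta> i = 0\<close>.\<close>
  define \<gamma> where "\<gamma> = (\<lambda>i. (if qf_appears (2 * r) G (2 * i + 1) then w' else w) * \<beta> i)"
  show thesis
  proof (rule that)
    show "\<gamma> i \<in> quad_ints D" if "i < r" for i
      using that \<beta> w w'_int by (auto simp: \<gamma>_def intro!: quad_ints_mult[OF D])
    show "\<gamma> i = 0" if "i < r" "gf_proper r G i" for i
      using \<beta>_0[OF that] by (simp add: \<gamma>_def)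
    have "gf_eval D r G \<gamma> = w\<^sup>2 * gf_eval D r G \<beta>"
      unfolding gf_eval_def
    proof (rule qf_eval_scale)
      fix p assume p: "p < 2 * r" "qf_appears (2 * r) G p"
      define i where "i = p div 2"
      have i: "i < r" "p = (if even p then 2 * i else 2 * i + 1)" using p by (auto simp: i_def)
      have conj: "quad_conj D (\<gamma> i) =
          (if qf_appears (2 * r) G (2 * i + 1) then w else w') * quad_conj D (\<beta> i)"
        using \<beta>(1)[OF i(1)] w_field conj_w'
        by (auto simp: \<gamma>_def quad_conj_mult[OF D] quad_ints_def w'_def)
      have "(if even p then \<gamma> i else quad_conj D (\<gamma> i)) =
            w * (if even p then \<beta> i else quad_conj D (\<beta> i))"
      proof (cases "gf_proper r G i")
        case True
        then show ?thesis using \<beta>_0[OF i(1)] by (simp add: \<gamma>_def quad_conj_0[OF D])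
      next
        case False
        \<comment> \<open>For a non-proper variable that appears, exactly one of the two slots
          occurs, so the parity of \<open>p\<close> tells which factor \<open>\<gamma>\<close>
          received.\<close>
        then have "qf_appears (2 * r) G (2 * i + 1) \<longleftrightarrow> odd p"
          using p(2) i(2) by (auto simp: gf_proper_def split: if_splits)
        then show ?thesis unfolding conj by (simp add: \<gamma>_def)
      qed
      then show "(if even p then \<gamma> (p div 2) else quad_conj D (\<gamma> (p div 2))) =
            w * (if even p then \<beta> (p div 2) else quad_conj D (\<beta> (p div 2)))"
        by (simp only: i_def)
    qed
    also have "\<dots> = (w * w') * (w * w') * \<alpha>"
      unfolding \<beta>(2) \<alpha>'_def by (simp only: power2_eq_square mult_ac)
    finally show "gf_eval D r G \<gamma> = \<alpha>" by (simp add: w')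
  qed
qed

theorem theorem7:
  fixes D r :: nat and G :: qform
  assumes "squarefree D" and "D > 1"
    and "gf_integral D r G"
    and "gf_tot_pos_definite D r G"
    and "gf_universal D r G"
  shows "\<exists>k H. gf_over_field D k H \<and> gf_subform k H r G \<and> gf_quadratic k H \<and> gf_universal D k H"
proof -
  note D = assms(1,2)
  interpret real_subfield "quad_field D" by (rule quad_field_subfield[OF D])
  obtain k \<sigma> where kr: "k \<le> r" and bij: "bij_betw \<sigma> {..<r} {..<r}"
    and im: "\<sigma> ` {..<k} = {i. i < r \<and> \<not> gf_proper r G i}"
    by (rule exists_nonproper_reordering)
  have less: "\<sigma> i < r" and nonproper: "\<not> gf_proper r G (\<sigma> i)" if "i < k" for i
    using im that by auto
  have inj: "inj_on \<sigma> {..<k}"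
    using bij kr by (auto simp: bij_betw_def intro: inj_on_subset)
  have lift_less: "gf_lift \<sigma> p < 2 * r" if "p < 2 * k" for p
    using gf_lift_less[of k \<sigma> r] less that by blast
  define H where "H = qf_select (gf_lift \<sigma>) G"
  have integral: "gf_integral D k H"
    using qf_select_over[OF _ lift_less] assms(3) by (simp add: gf_integral_def H_def)
  then have "gf_over_field D k H"
    by (auto simp: gf_integral_def gf_over_field_def qf_over_def quad_ints_def)
  moreover have "gf_subform k H r G"
    using kr bij by (auto simp: gf_subform_def H_def)
  moreover have "gf_quadratic k H"
    unfolding gf_quadratic_def
  proof (intro allI impI notI)
    fix i assume i: "i < k" "gf_proper k H i"
    \<comment> \<open>Restriction only deletes monomials, so a variable proper in \<open>H\<close>
      would already be proper in \<open>G\<close>.\<close>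
    have "qf_appears (2 * r) G (gf_lift \<sigma> p)" if "qf_appears (2 * k) H p" for p
      using qf_appears_select[OF that[unfolded H_def] lift_less] .
    from this[of "2 * i"] this[of "2 * i + 1"] have "gf_proper r G (\<sigma> i)"
      using i(2) by (simp add: gf_proper_def gf_lift_def)
    then show False using nonproper i(1) by blast
  qed
  moreover have "gf_universal D k H"
    unfolding gf_universal_def
  proof (intro conjI ballI)
    show "gf_tot_pos_semidefinite D k H"
    proof (rule gf_tot_pos_semidefiniteI[OF zero_closed])
      fix x assume "\<And>i. i < 2 * k \<Longrightarrow> x i \<in> quad_field D"
      then show "tot_nonneg D (qf_eval (2 * k) H x)"
        unfolding H_def using gf_lift_inj[OF inj] lift_less zero_closed
          gf_tot_pos_definite_imp_tot_nonneg[OF quad_conj_0[OF D] assms(4)]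
        by (intro select_eval_property[where P = "tot_nonneg D" and F = "quad_field D"]) auto
    qed
  next
    fix \<alpha> assume "\<alpha> \<in> tot_pos_ints D"
    then obtain \<gamma> where \<gamma>: "\<And>i. i < r \<Longrightarrow> \<gamma> i \<in> quad_ints D" "gf_eval D r G \<gamma> = \<alpha>"
      "\<And>i. i < r \<Longrightarrow> gf_proper r G i \<Longrightarrow> \<gamma> i = 0"
      using gf_represents_with_proper_vanishing[OF D assms(4,5)] by blast
    have "gf_eval D k H (\<lambda>i. \<gamma> (\<sigma> i)) = \<alpha>"
      unfolding H_def \<gamma>(2)[symmetric]
      by (rule gf_eval_select_lift[OF inj less quad_conj_0[OF D]]) (use im \<gamma>(3) in auto)
    then show "gf_represents D k H \<alpha>"
      using \<gamma>(1) less by (auto simp: gf_represents_def intro!: exI[of _ "\<lambda>i. \<gamma> (\<sigma> i)"])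
  qed (rule integral)
  ultimately show ?thesis by blast
qed

end
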